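(* Let $A$ be a unital commutative associative superalgebra over $\mathbb{F}$. Then $(\Pi\,\mathcal{G}W^{as}(\Pi A),[\cdot,\cdot],\wedge)$ is a $\mathbb{Z}_+$-graded odd generalized Poisson superalgebra.
   Context: The base field $\mathbb{F}$ is algebraically closed of characteristic $0$. $\Pi$ denotes parity reversal; $p$ is the parity of $A$ and $\bar p=p+\bar 1$ the parity of $\Pi A$. Generalized derivations. A linear map $X:A\to A$ is a generalized derivation if $X(bc)=X(b)c+(-1)^{p(b)p(c)}X(c)b-X(1)bc$ for all (homogeneous) $b,c$; $GDer(A)$ is the set of these. It is a subalgebra of the Lie superalgebra $\mathrm{End}(A)=\mathrm{End}(\Pi A)$. The Lie superalgebra $W(\Pi A)$. $W(\Pi A)=\bigoplus_{k\ge -1}W_k(\Pi A)$ with $W_{-1}(\Pi A)=\Pi A$ and, for $k\ge0$, $W_k(\Pi A)=\mathrm{Hom}(S^{k+1}(\Pi A),\Pi A)$, the superspace of $(k+1)$-linear supersymmetric functions on $\Pi A$ with values in $\Pi A$ (parity $\bar p$). For $X\in W_p(\Pi A)$, $Y\in W_q(\Pi A)$, $X\Box Y\in W_{p+q}(\Pi A)$ is $$X\Box Y(a_0,\dots,a_{p+q})=\sum_{\substack{i_0<\dots<i_q\\ i_{q+1}<\dots<i_{q+p}}}\epsilon_a(i_0,\dots,i_{p+q})X(Y(a_{i_0},\dots,a_{i_q}),a_{i_{q+1}},\dots,a_{i_{q+p}}),$$ where the sum is over permutations of $0,\dots,p+q$ and $\epsilon_a=(-1)^N$, $N$ being the number of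 interchanges of indices of odd (in $\Pi A$) $a_i$'s in the permutation; $X\Box Y=0$ if $X\in W_{-1}(\Pi A)$. The Lie bracket is $[X,Y]=X\Box Y-(-1)^{\bar p(X)\bar p(Y)}Y\Box X$. The full prolongation. $\mathcal{G}W^{as}(\Pi A)=\bigoplus_{k\ge-1}\mathcal{G}W^{as}_k(\Pi A)\subseteq W(\Pi A)$, with $\mathcal{G}W^{as}_{-1}(\Pi A)=\Pi A$, $\mathcal{G}W^{as}_0(\Pi A)=GDer(A)$, and $\mathcal{G}W^{as}_k(\Pi A)=\{X\in W_k(\Pi A): [X,W_{-1}(\Pi A)]\subset\mathcal{G}W^{as}_{k-1}(\Pi A)\}$ for $k\ge1$. Concatenation product. On $\Pi W(\Pi A)$ (parity $p=\bar p+\bar1$), for $X\in\Pi W_{h-1}(\Pi A)$, $Y\in\Pi W_{k-1}(\Pi A)$, $h,k\ge0$, $X\wedge Y\in\Pi W_{h+k-1}(\Pi A)$ is $$X\wedge Y(a_1,\dots,a_{h+k})=\sum_{\substack{i_1<\dots<i_h\\ i_{h+1}<\dots<i_{h+k}}}\epsilon_a(i_1,\dots,i_{h+k})(-1)^{p(Y)(\bar p(a_{i_1})+\dots+\bar p(a_{i_h}))}X(a_{i_1},\dots,a_{i_h})Y(a_{i_{h+1}},\dots,a_{i_{h+k}}),$$ the product on the right being that of $A$. Odd generalized Poisson superalgebra. A triple $(\mathcal{P},[\cdot,\cdot],\wedge)$ such that $(\mathcal{P},\wedge)$ is a unital associative commutative superalgebra with parity $p$, $(\Pi\mathcal{P},[\cdot,\cdot])$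 is a Lie superalgebra, and $[a,b\wedge c]=[a,b]\wedge c+(-1)^{(p(a)+1)p(b)}b\wedge[a,c]+(-1)^{p(a)+1}D(a)\wedge b\wedge c$, where $D(a)=[1,a]$. It is $\mathbb{Z}_+$-graded if $\Pi\mathcal{P}=\bigoplus_{j\ge-1}\mathcal{P}_j$ is a $\mathbb{Z}$-graded Lie superalgebra, $\mathcal{P}=\bigoplus_{k\ge0}\mathcal{Q}_k$ is a graded commutative associative superalgebra, and $\mathcal{P}_j=\Pi\mathcal{Q}_{j+1}$. Here the grading is the one with $\mathcal{P}_j=\mathcal{G}W^{as}_j(\Pi A)$. *)

theory Defs
  imports
    "HOL-Computational_Algebra.Polynomial"
    "HOL-Library.Z2"
    "HOL-Library.Function_Algebras"
begin

section \<open>Superspaces and superalgebras\<close>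

text \<open>Parities are elements of \<^typ>\<open>bit\<close>, the field \<open>\<int>/2\<int>\<close>. The scalar \<open>(-1)\<^sup>e\<close> acts on vectors as follows.\<close>

definition ksign :: "bit \<Rightarrow> 'v::group_add \<Rightarrow> 'v" where
  "ksign e v = (if e = 1 then - v else v)"

definition (in vector_space) internal_direct_sum :: "('i \<Rightarrow> 'b set) \<Rightarrow> 'b set \<Rightarrow> bool" where
  "internal_direct_sum U V \<longleftrightarrow>
     (\<forall>i. subspace (U i)) \<and> V = span (\<Union>i. U i) \<and>
     (\<forall>F f. finite F \<longrightarrow> (\<forall>i\<in>F. f i \<in> U i) \<longrightarrow> (\<Sum>i\<in>F. f i) = 0 \<longrightarrow> (\<forall>i\<in>F. f i = 0))"

text \<open>
  A superspace is a subspace \<open>V\<close> of an ambient vector space together with its even part \<open>par 0\<close>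
  and its odd part \<open>par 1\<close>.
\<close>

locale superspace = vector_space scale
  for scale :: "'f::field \<Rightarrow> 'v::ab_group_add \<Rightarrow> 'v" +
  fixes V :: "'v set" and par :: "bit \<Rightarrow> 'v set"
  assumes parity_decomposition: "internal_direct_sum par V"

definition parity_shift :: "(bit \<Rightarrow> 'v set) \<Rightarrow> bit \<Rightarrow> 'v set" where
  "parity_shift par e = par (e + 1)"

text \<open>The component of parity \<open>e\<close> of a vector; meaningful for elements of a superspace with parity \<open>par\<close>.\<close>

definition hcomp :: "(bit \<Rightarrow> 'v::ab_group_add set) \<Rightarrow> bit \<Rightarrow> 'v \<Rightarrow> 'v" where
  "hcomp par e x = (THE y. y \<in> par e \<and> x - y \<in> par (e + 1))"

locale superalgebra = superspace scale V par
  for scale :: "'f::field \<Rightarrow> 'v::ab_group_add \<Rightarrow> 'v" and V par +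
  fixes mult :: "'v \<Rightarrow> 'v \<Rightarrow> 'v"
  assumes mult_closed: "x \<in> V \<Longrightarrow> y \<in> V \<Longrightarrow> mult x y \<in> V"
    and mult_add_left: "x \<in> V \<Longrightarrow> y \<in> V \<Longrightarrow> z \<in> V \<Longrightarrow> mult (x + y) z = mult x z + mult y z"
    and mult_add_right: "x \<in> V \<Longrightarrow> y \<in> V \<Longrightarrow> z \<in> V \<Longrightarrow> mult x (y + z) = mult x y + mult x z"
    and mult_scale_left: "x \<in> V \<Longrightarrow> y \<in> V \<Longrightarrow> mult (scale c x) y = scale c (mult x y)"
    and mult_scale_right: "x \<in> V \<Longrightarrow> y \<in> V \<Longrightarrow> mult x (scale c y) = scale c (mult x y)"
    and mult_parity: "x \<in> par a \<Longrightarrow> y \<in> par b \<Longrightarrow> mult x y \<in> par (a + b)"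

locale unital_comm_superalgebra = superalgebra scale V par mult
  for scale :: "'f::field \<Rightarrow> 'v::ab_group_add \<Rightarrow> 'v" and V par mult +
  fixes unit :: 'v
  assumes assoc: "x \<in> V \<Longrightarrow> y \<in> V \<Longrightarrow> z \<in> V \<Longrightarrow> mult (mult x y) z = mult x (mult y z)"
    and supercomm: "x \<in> par a \<Longrightarrow> y \<in> par b \<Longrightarrow> mult x y = ksign (a * b) (mult y x)"
    and unit_closed: "unit \<in> V"
    and unit_left: "x \<in> V \<Longrightarrow> mult unit x = x"
    and unit_right: "x \<in> V \<Longrightarrow> mult x unit = x"

locale lie_superalgebra = superalgebra scale V par bracket
  for scale :: "'f::field \<Rightarrow> 'v::ab_group_add \<Rightarrow> 'v" and V par bracket +
  assumes superskew: "x \<in> par a \<Longrightarrow> y \<in> par b \<Longrightarrow> bracket x y = - ksign (a * b) (bracket y x)"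
    and superjacobi: "x \<in> par a \<Longrightarrow> y \<in> par b \<Longrightarrow> z \<in> V \<Longrightarrow>
      bracket x (bracket y z) =
        bracket (bracket x y) z + ksign (a * b) (bracket y (bracket x z))"


section \<open>Odd generalized Poisson superalgebras\<close>

locale odd_generalized_poisson_superalgebra =
  unital_comm_superalgebra scale P par wedge unit +
  lie: lie_superalgebra scale P "parity_shift par" bracket
  for scale :: "'f::field \<Rightarrow> 'v::ab_group_add \<Rightarrow> 'v"
    and P par bracket wedge unit +
  assumes leibniz: "x \<in> par a \<Longrightarrow> y \<in> par b \<Longrightarrow> z \<in> P \<Longrightarrow>
      bracket x (wedge y z) =
        wedge (bracket x y) z
        + ksign ((a + 1) * b) (wedge y (bracket x z))
        + ksign (a + 1) (wedge (wedge (bracket unit x) y) z)"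

locale Zplus_graded_odd_generalized_poisson_superalgebra =
  odd_generalized_poisson_superalgebra scale P par bracket wedge unit
  for scale :: "'f::field \<Rightarrow> 'v::ab_group_add \<Rightarrow> 'v"
    and P par bracket wedge unit +
  fixes Pdeg :: "int \<Rightarrow> 'v set" and Qdeg :: "nat \<Rightarrow> 'v set"
  assumes lie_decomposition: "internal_direct_sum Pdeg P"
    and lie_subsuperspace: "internal_direct_sum (\<lambda>e. Pdeg j \<inter> parity_shift par e) (Pdeg j)"
    and lie_depth: "j < -1 \<Longrightarrow> Pdeg j = {0}"
    and lie_graded: "x \<in> Pdeg i \<Longrightarrow> y \<in> Pdeg j \<Longrightarrow> bracket x y \<in> Pdeg (i + j)"
    and comm_decomposition: "internal_direct_sum Qdeg P"
    and comm_subsuperspace: "internal_direct_sum (\<lambda>e. Qdeg k \<inter> par e) (Qdeg k)"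
    and comm_graded: "x \<in> Qdeg h \<Longrightarrow> y \<in> Qdeg k \<Longrightarrow> wedge x y \<in> Qdeg (h + k)"
    and degree_shift: "j \<ge> -1 \<Longrightarrow> Pdeg j = Qdeg (nat (j + 1))"


section \<open>The Lie superalgebra \<open>W(\<Pi>A)\<close>\<close>

text \<open>
  The superalgebra \<open>A\<close> is a whole type, with parity \<open>par\<close>. An element of \<open>W\<^sub>n\<^sub>-\<^sub>1(\<Pi>A)\<close> is a function on
  lists over \<open>A\<close> which vanishes off the lists of length \<open>n\<close>; an element \<open>a\<close> of \<open>W\<^sub>-\<^sub>1(\<Pi>A) = \<Pi>A\<close>
  is the function with value \<open>a\<close> at the empty list. Sums of such functions for different \<open>n\<close>
  make up \<open>W(\<Pi>A)\<close>.
\<close>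

definition fscale :: "('f \<Rightarrow> 'a \<Rightarrow> 'a) \<Rightarrow> 'f \<Rightarrow> ('a list \<Rightarrow> 'a) \<Rightarrow> 'a list \<Rightarrow> 'a" where
  "fscale scale c X = (\<lambda>as. scale c (X as))"

text \<open>
  \<open>shuffle_perms n\<close> consists of the permutations \<open>is @ js\<close> of \<open>0, \<dots>, n - 1\<close> with \<open>is\<close> and \<open>js\<close> increasing,
  and \<open>koszul ds (is @ js)\<close> is the exponent (mod 2) of the sign \<open>\<epsilon>\<^sub>a\<close> for arguments \<open>a\<^sub>i\<close> of parity \<open>ds ! i\<close>.
\<close>

definition shuffle_perms :: "nat \<Rightarrow> (nat list \<times> nat list) set" where
  "shuffle_perms n = {(is, js). sorted_wrt (<) is \<and> sorted_wrt (<) js \<and>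
      set is \<inter> set js = {} \<and> set is \<union> set js = {..<n}}"

definition koszul :: "bit list \<Rightarrow> nat list \<Rightarrow> bit" where
  "koszul ds is = of_nat (card {(r, s). r < s \<and> s < length is \<and> is ! s < is ! r \<and>
      ds ! (is ! r) = 1 \<and> ds ! (is ! s) = 1})"

context
  fixes scale :: "'f::field \<Rightarrow> 'a::{ring,monoid_mult} \<Rightarrow> 'a"
    and par :: "bit \<Rightarrow> 'a set"
begin

definition W_hom :: "int \<Rightarrow> ('a list \<Rightarrow> 'a) set" where
  "W_hom k = (if k < -1 then {0} else
     {X. (\<forall>as. int (length as) \<noteq> k + 1 \<longrightarrow> X as = 0) \<and>
         (\<forall>as i. int (length as) = k + 1 \<longrightarrow> i < length as \<longrightarrow>
            Vector_Spaces.linear scale scale (\<lambda>x. X (as[i := x]))) \<and>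
         (\<forall>as i d e. int (length as) = k + 1 \<longrightarrow> Suc i < length as \<longrightarrow>
            as ! i \<in> parity_shift par d \<longrightarrow> as ! Suc i \<in> parity_shift par e \<longrightarrow>
            X (as[i := as ! Suc i, Suc i := as ! i]) = ksign (d * e) (X as))})"

definition W :: "('a list \<Rightarrow> 'a) set" where
  "W = module.span (fscale scale) (\<Union>k. W_hom k)"

definition W_par :: "bit \<Rightarrow> ('a list \<Rightarrow> 'a) set" where
  "W_par e = {X \<in> W. \<forall>as ds. list_all2 (\<lambda>a d. a \<in> parity_shift par d) as ds \<longrightarrow>
     X as \<in> parity_shift par (e + sum_list ds)}"

text \<open>
  The defining formulas of \<open>\<box>\<close>, \<open>[\<cdot>,\<cdot>]\<close> and \<open>\<and>\<close> carry signs and so are given for homogeneous data.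
  Multilinear extension to all arguments and operands is achieved by summing over the parities
  \<open>ds\<close> of the components of the arguments, and over the parities of the components of \<open>X\<close> and \<open>Y\<close>.
  No restriction on the lengths of \<open>is\<close> and \<open>js\<close> is needed: for \<open>X\<close> and \<open>Y\<close> of fixed degrees,
  a summand with \<open>is\<close> or \<open>js\<close> of a length other than the prescribed one is zero.
\<close>

definition hcomps :: "bit list \<Rightarrow> 'a list \<Rightarrow> 'a list" where
  "hcomps ds as = map2 (hcomp (parity_shift par)) ds as"

definition box :: "('a list \<Rightarrow> 'a) \<Rightarrow> ('a list \<Rightarrow> 'a) \<Rightarrow> 'a list \<Rightarrow> 'a" where
  "box X Y as =
     (\<Sum>ds | length ds = length as. \<Sum>(is, js)\<in>shuffle_perms (length as).
        let b = (!) (hcomps ds as)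
        in ksign (koszul ds (is @ js)) (X (Y (map b is) # map b js)))"

definition W_bracket :: "('a list \<Rightarrow> 'a) \<Rightarrow> ('a list \<Rightarrow> 'a) \<Rightarrow> 'a list \<Rightarrow> 'a" where
  "W_bracket X Y =
     (\<Sum>d\<in>UNIV. \<Sum>e\<in>UNIV.
        let X' = hcomp W_par d X; Y' = hcomp W_par e Y
        in box X' Y' - ksign (d * e) (box Y' X'))"

definition concat_prod :: "('a list \<Rightarrow> 'a) \<Rightarrow> ('a list \<Rightarrow> 'a) \<Rightarrow> 'a list \<Rightarrow> 'a" where
  "concat_prod X Y as =
     (\<Sum>e\<in>UNIV. \<Sum>ds | length ds = length as. \<Sum>(is, js)\<in>shuffle_perms (length as).
        let Y' = hcomp (parity_shift W_par) e Y; b = (!) (hcomps ds as)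
        in ksign (koszul ds (is @ js) + e * (\<Sum>i\<leftarrow>is. ds ! i)) (X (map b is) * Y' (map b js)))"

definition W_const :: "'a \<Rightarrow> 'a list \<Rightarrow> 'a" where
  "W_const a = (\<lambda>as. if as = [] then a else 0)"


section \<open>The full prolongation\<close>

definition GDer :: "('a \<Rightarrow> 'a) set" where
  "GDer = {D. Vector_Spaces.linear scale scale D \<and>
     (\<forall>d e b c. b \<in> par d \<longrightarrow> c \<in> par e \<longrightarrow>
        D (b * c) = D b * c + ksign (d * e) (D c * b) - D 1 * b * c)}"

text \<open>\<open>GW_arity n\<close> is the component of degree \<open>n - 1\<close>, i.e. the one made of \<open>n\<close>-ary functions.\<close>

fun GW_arity :: "nat \<Rightarrow> ('a list \<Rightarrow> 'a) set" where
  "GW_arity 0 = W_hom (-1)"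
| "GW_arity (Suc 0) = {X \<in> W_hom 0. (\<lambda>a. X [a]) \<in> GDer}"
| "GW_arity (Suc (Suc n)) =
     {X \<in> W_hom (int n + 1). \<forall>Y\<in>W_hom (-1). W_bracket X Y \<in> GW_arity (Suc n)}"

definition GW_hom :: "int \<Rightarrow> ('a list \<Rightarrow> 'a) set" where
  "GW_hom k = (if k < -1 then {0} else GW_arity (nat (k + 1)))"

definition GW :: "('a list \<Rightarrow> 'a) set" where
  "GW = module.span (fscale scale) (\<Union>k. GW_hom k)"

definition GW_par :: "bit \<Rightarrow> ('a list \<Rightarrow> 'a) set" where
  "GW_par e = GW \<inter> W_par e"

end

end

theory Submission
  imports Defs
begin

text \<open>
  Apart from bilinearity and the count of degrees, all that is needed of the shuffle formulas for \<open>\<box>\<close>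
  and \<open>\<and>\<close> is their value at the empty list and the effect of the first argument. Write \<open>X\<^sub>a(b, \<dots>) = X(a, b, \<dots>)\<close> for the contraction of \<open>X\<close> with a homogeneous \<open>a\<close> in
  \<open>\<Pi>A\<close>. The index \<open>0\<close> is the first entry of one of the two increasing sequences of a shuffle, so

  \<^item> \<open>(X \<box> Y)\<^sub>a = X \<box> Y\<^sub>a + (-1)\<^sup>p X\<^sub>a \<box> Y\<close> where \<open>p\<close> is the product of the parities of
    \<open>a\<close> in \<open>\<Pi>A\<close> and of \<open>Y\<close> in \<open>W(\<Pi>A)\<close> (\<open>contract_box\<close>),
  \<^item> \<open>(X \<and> Y)\<^sub>a = (-1)\<^sup>q X\<^sub>a \<and> Y + X \<and> Y\<^sub>a\<close> where \<open>q\<close> is the product of the parities of \<open>a\<close>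
    in \<open>\<Pi>A\<close> and of \<open>Y\<close> in \<open>\<Pi>W(\<Pi>A)\<close> (\<open>contract_concat\<close>),

  and therefore contraction is a superderivation of the bracket (\<open>contract_bracket\<close>). On the empty
  list the values are \<open>X(Y())\<close> and \<open>X()Y()\<close>.

  Each identity between multilinear functions is now proved by induction on a homogeneous list of
  arguments, for all functions at once: the contraction of the identity is a signed sum of the same
  identity for tuples in which one function is contracted, and what remains is its value at the
  empty list. There, associativity and supercommutativity of \<open>\<and>\<close> become those of \<open>A\<close>, the Jacobi
  identity reduces to a cancellation that uses the supersymmetry of functions of two arguments, and
  the Leibniz rule for \<open>X\<close>, \<open>Y\<close> and \<open>Z\<close> (\<open>leibniz_homogeneous\<close>) becomes the statement that
  \<open>a \<mapsto> X(a)\<close> is a generalized derivation on the product of \<open>Y()\<close> and \<open>Z()\<close>.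

  Since \<open>[X, a] = X\<^sub>a\<close> for \<open>a\<close> in \<open>W\<^sub>-\<^sub>1(\<Pi>A)\<close>, the full prolongation consists of those \<open>X\<close> in \<open>W(\<Pi>A)\<close>
  for which \<open>a \<mapsto> X(b\<^sub>1, \<dots>, b\<^sub>n, a)\<close> is a generalized derivation for all \<open>b\<^sub>1, \<dots>, b\<^sub>n\<close> (\<open>GW_eq\<close>). This
  condition is stable under contraction, so that closure under \<open>\<and>\<close> and under the bracket also
  follows by induction on a list. It comes down to two facts on \<open>A\<close>: generalized derivations form a
  Lie superalgebra (\<open>GDer_commutator\<close>) and a left \<open>A\<close>-module (\<open>GDer_mult_left\<close>).
\<close>

section \<open>Signs and parity components\<close>

text \<open>Parities are added and multiplied as elements of a field; rewriting these operations to
  Boolean ones is of no use here.\<close>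

declare add_bit_eq_xor [simp del] mult_bit_eq_and [simp del]

lemma bit_add_self [simp]: "(e :: bit) + e = 0"
  by (cases e) simp_all

lemma UNIV_bit: "(UNIV :: bit set) = {0, 1}"
  using bit_not_zero_iff by blast

lemma finite_UNIV_bit [simp]: "finite (UNIV :: bit set)"
  by (simp add: UNIV_bit)

lemma sum_UNIV_bit: "(\<Sum>d\<in>(UNIV :: bit set). f d) = f 0 + f 1"
  for f :: "bit \<Rightarrow> 'v::comm_monoid_add"
  by (simp add: UNIV_bit)

lemma bit_add_one_add_one [simp]: "(e :: bit) + 1 + 1 = e"
  by (cases e) simp_all

lemma ksign_0 [simp]: "ksign 0 v = v"
  by (simp add: ksign_def)

lemma ksign_1 [simp]: "ksign 1 v = - v"
  by (simp add: ksign_def)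

lemma ksign_ksign [simp]: "ksign d (ksign e v) = ksign (d + e) v"
  by (cases d; cases e) simp_all

lemma ksign_zero [simp]: "ksign e 0 = 0"
  by (simp add: ksign_def)

lemma ksign_plus: "ksign e (v + w) = ksign e v + ksign e w" for v :: "'v::ab_group_add"
  by (simp add: ksign_def)

lemma ksign_minus: "ksign e (- v) = - ksign e v"
  by (simp add: ksign_def)

lemma ksign_sum: "ksign e (\<Sum>i\<in>I. f i) = (\<Sum>i\<in>I. ksign e (f i))" for f :: "'i \<Rightarrow> 'v::ab_group_add"
  by (simp add: ksign_def sum_negf)

lemma ksign_apply: "ksign e X as = ksign e (X as)" for X :: "'b \<Rightarrow> 'v::ab_group_add"
  by (simp add: ksign_def)

lemma ksign_mult_left: "ksign e v * w = ksign e (v * w)" for v :: "'v::ring"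
  by (simp add: ksign_def)

lemma ksign_mult_right: "v * ksign e w = ksign e (v * w)" for v :: "'v::ring"
  by (simp add: ksign_def)

context vector_space
begin

lemma scale_ksign: "scale c (ksign e v) = ksign e (scale c v)"
  by (simp add: ksign_def scale_minus_right)

lemma subspace_ksign: "subspace U \<Longrightarrow> v \<in> U \<Longrightarrow> ksign e v \<in> U"
  by (simp add: ksign_def subspace_neg)

lemma internal_direct_sum_bitI:
  fixes U :: "bit \<Rightarrow> 'b set"
  assumes sub: "\<And>e. subspace (U e)" "subspace V"
    and le: "\<And>e. U e \<subseteq> V"
    and dec: "\<And>x. x \<in> V \<Longrightarrow> \<exists>y\<in>U 0. \<exists>z\<in>U 1. x = y + z"
    and dis: "U 0 \<inter> U 1 = {0}"
  shows "internal_direct_sum U V"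
  unfolding internal_direct_sum_def
proof (intro conjI allI impI ballI)
  show "subspace (U i)" for i by (fact sub)
  show "V = span (\<Union>i. U i)"
  proof
    show "V \<subseteq> span (\<Union>i. U i)"
    proof
      fix x assume "x \<in> V"
      with dec obtain y z where yz: "y \<in> U 0" "z \<in> U 1" "x = y + z" by blast
      then have "y \<in> (\<Union>i. U i)" "z \<in> (\<Union>i. U i)" by blast+
      then show "x \<in> span (\<Union>i. U i)" unfolding yz(3) by (intro span_add span_base)
    qed
    show "span (\<Union>i. U i) \<subseteq> V" using le sub(2) by (intro span_minimal) auto
  qed
next
  fix F :: "bit set" and f i
  assume f: "\<forall>i\<in>F. f i \<in> U i" and s: "(\<Sum>i\<in>F. f i) = 0" and i: "i \<in> F"
  have "F \<subseteq> {0, 1}" using UNIV_bit by blast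
  with i consider "F = {0}" | "F = {1}" | "F = {0, 1}" by blast
  then show "f i = 0"
  proof cases
    case 3
    from s 3 have eq: "f 0 = - f 1" by (simp add: eq_neg_iff_add_eq_0)
    with f 3 sub have "f 0 \<in> U 0 \<inter> U 1" by (metis IntI insertI1 insertI2 subspace_neg)
    with dis have "f 0 = 0" by simp
    with eq show ?thesis by (cases i) simp_all
  qed (use s i in auto)
qed

end

context superspace
begin

lemma par_subspace: "subspace (par e)"
  using parity_decomposition by (auto simp: internal_direct_sum_def)

lemma V_subspace: "subspace V"
  using parity_decomposition by (auto simp: internal_direct_sum_def)

lemma par_subset: "par e \<subseteq> V"
  using parity_decomposition by (auto simp: internal_direct_sum_def intro: span_base)

lemma zero_in_par [simp]: "0 \<in> par e"
  using par_subspace subspace_0 by blast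

lemma ksign_in_par: "x \<in> par d \<Longrightarrow> ksign e x \<in> par d"
  using par_subspace subspace_ksign by blast

lemma par_disjoint:
  assumes "x \<in> par e" "x \<in> par (e + 1)"
  shows "x = 0"
proof -
  have 0: "x \<in> par 0" "x \<in> par 1" using assms by (cases e; simp)+
  define f where "f i = (if i = (0::bit) then x else - x)" for i
  have indep: "\<forall>F f. finite F \<longrightarrow> (\<forall>i\<in>F. f i \<in> par i) \<longrightarrow> (\<Sum>i\<in>F. f i) = 0 \<longrightarrow> (\<forall>i\<in>F. f i = 0)"
    using parity_decomposition unfolding internal_direct_sum_def by (elim conjE)
  have "finite (UNIV :: bit set)" by simp
  moreover have "\<forall>i\<in>UNIV. f i \<in> par i"
    using 0 par_subspace by (auto simp: f_def subspace_neg)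
  moreover have "(\<Sum>i\<in>UNIV. f i) = 0" by (simp add: sum_UNIV_bit f_def)
  ultimately have "\<forall>i\<in>UNIV. f i = 0"
    using indep[THEN spec[of _ UNIV], THEN spec[of _ f]] by (elim impE)
  then have "f 0 = 0" by blast
  then show ?thesis by (simp add: f_def)
qed

lemma hcomp_eq:
  assumes "y \<in> par e" "z \<in> par (e + 1)"
  shows "hcomp par e (y + z) = y"
  unfolding hcomp_def
proof (rule the_equality)
  show "y \<in> par e \<and> y + z - y \<in> par (e + 1)" using assms by simp
next
  fix w assume w: "w \<in> par e \<and> y + z - w \<in> par (e + 1)"
  have "w - y \<in> par e" using w assms par_subspace subspace_diff by blast
  moreover have "w - y = z - (y + z - w)" by simp
  then have "w - y \<in> par (e + 1)" using w assms par_subspace subspace_diff by metis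
  ultimately show "w = y" using par_disjoint[of "w - y" e] by simp
qed

lemma V_decomp:
  assumes "x \<in> V" obtains y z where "y \<in> par e" "z \<in> par (e + 1)" "x = y + z"
proof -
  have "x \<in> span (\<Union>e. par e)"
    using assms parity_decomposition by (simp add: internal_direct_sum_def)
  then have "\<exists>y\<in>par e. \<exists>z\<in>par (e + 1). x = y + z"
  proof (induction rule: span_induct_alt)
    case base then show ?case by (intro bexI[of _ 0]) auto
  next
    case (step c x w)
    then obtain y z i where yz: "y \<in> par e" "z \<in> par (e + 1)" "w = y + z" and x: "x \<in> par i" by blast
    have "i = e \<or> i = e + 1" by (cases i; cases e) auto
    then show ?case
    proof
      assume "i = e"
      then have "scale c x + y \<in> par e"
        using x yz par_subspace by (metis subspace_add subspace_scale)
      with yz show ?case by (intro bexI[of _ "scale c x + y"] bexI[of _ z]) (auto simp: add.assoc)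
    next
      assume "i = e + 1"
      then have "scale c x + z \<in> par (e + 1)"
        using x yz par_subspace by (metis subspace_add subspace_scale)
      with yz show ?case by (intro bexI[of _ y] bexI[of _ "scale c x + z"]) (auto simp: algebra_simps)
    qed
  qed
  with that show ?thesis by blast
qed

lemma hcomp_in_par: "x \<in> V \<Longrightarrow> hcomp par e x \<in> par e"
  by (metis V_decomp hcomp_eq)

lemma hcomp_sum: "x \<in> V \<Longrightarrow> hcomp par 0 x + hcomp par 1 x = x"
proof -
  assume "x \<in> V"
  then obtain y z where *: "y \<in> par 0" "z \<in> par (0 + 1)" "x = y + z" by (rule V_decomp)
  then show ?thesis using hcomp_eq[of y 0 z] hcomp_eq[of z 1 y] by (simp add: add.commute)
qed

lemma hcomp_id: "x \<in> par e \<Longrightarrow> hcomp par e x = x"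
  using hcomp_eq[of x e 0] by simp

lemma hcomp_other: "x \<in> par (e + 1) \<Longrightarrow> hcomp par e x = 0"
  using hcomp_eq[of 0 e x] by simp

lemma hcomp_homogeneous: "x \<in> par d \<Longrightarrow> hcomp par e x = (if e = d then x else 0)"
  using hcomp_id[of x d] hcomp_other[of x e] by (cases d; cases e) auto

lemma hcomp_add:
  assumes "x \<in> V" "y \<in> V" shows "hcomp par e (x + y) = hcomp par e x + hcomp par e y"
proof -
  obtain x0 x1 y0 y1 where *: "x0 \<in> par e" "x1 \<in> par (e + 1)" "x = x0 + x1"
    "y0 \<in> par e" "y1 \<in> par (e + 1)" "y = y0 + y1" using assms by (metis V_decomp)
  have "x + y = (x0 + y0) + (x1 + y1)" using * by (simp add: algebra_simps)
  moreover have "x0 + y0 \<in> par e" "x1 + y1 \<in> par (e + 1)"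
    using * par_subspace subspace_add by blast+
  ultimately show ?thesis using * by (simp only: hcomp_eq)
qed

lemma hcomp_scale:
  assumes "x \<in> V" shows "hcomp par e (scale c x) = scale c (hcomp par e x)"
proof -
  obtain x0 x1 where *: "x0 \<in> par e" "x1 \<in> par (e + 1)" "x = x0 + x1" using assms by (metis V_decomp)
  have "scale c x0 \<in> par e" "scale c x1 \<in> par (e + 1)" using * par_subspace subspace_scale by blast+
  then show ?thesis using * by (simp add: scale_right_distrib hcomp_eq)
qed

text \<open>An additive statement need only be checked on homogeneous vectors.\<close>

lemma homogeneous_induct [consumes 1, case_names add homogeneous]:
  assumes "x \<in> V"
    and "\<And>y z. y \<in> V \<Longrightarrow> z \<in> V \<Longrightarrow> P y \<Longrightarrow> P z \<Longrightarrow> P (y + z)"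
    and "\<And>e y. y \<in> par e \<Longrightarrow> P y"
  shows "P x"
  using assms hcomp_sum[of x] hcomp_in_par[of x] par_subset by (metis subsetD)

lemma superspace_parity_shift: "superspace scale V (parity_shift par)"
proof (unfold_locales, rule internal_direct_sum_bitI)
  fix x assume "x \<in> V"
  then obtain y z where "y \<in> par 1" "z \<in> par (1 + 1)" "x = y + z" by (rule V_decomp)
  then show "\<exists>y\<in>parity_shift par 0. \<exists>z\<in>parity_shift par 1. x = y + z"
    by (auto simp: parity_shift_def)
next
  show "parity_shift par 0 \<inter> parity_shift par 1 = {0}"
    using par_disjoint[of _ 0] by (auto simp: parity_shift_def)
qed (use par_subspace V_subspace par_subset in \<open>auto simp: parity_shift_def\<close>)

end

lemma parity_shift_shift [simp]: "parity_shift (parity_shift par) = par"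
  by (rule ext) (simp add: parity_shift_def)

lemma hcomp_parity_shift: "hcomp (parity_shift par) e = hcomp par (e + 1)"
  by (rule ext) (simp add: hcomp_def parity_shift_def)


lemma sum_fun_apply: "(\<Sum>i\<in>I. f i) x = (\<Sum>i\<in>I. f i x)" for f :: "'i \<Rightarrow> 'b \<Rightarrow> 'c::comm_monoid_add"
  by (induction I rule: infinite_finite_induct) simp_all


section \<open>Shuffles and Koszul signs\<close>

lemma length_shuffle:
  assumes "(is, js) \<in> shuffle_perms n" shows "length is + length js = n"
proof -
  have "distinct is" "distinct js" "set is \<inter> set js = {}" "set is \<union> set js = {..<n}"
    using assms by (auto simp: shuffle_perms_def strict_sorted_iff)
  then have "length is + length js = card (set is \<union> set js)"
    by (metis List.finite_set card_Un_disjoint distinct_card)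
  with \<open>set is \<union> set js = {..<n}\<close> show ?thesis by simp
qed

lemma finite_shuffle_perms [simp]: "finite (shuffle_perms n)"
proof (rule finite_subset)
  let ?L = "{xs. set xs \<subseteq> {..<n} \<and> length xs \<le> n}"
  show "shuffle_perms n \<subseteq> ?L \<times> ?L"
  proof clarify
    fix xs ys assume *: "(xs, ys) \<in> shuffle_perms n"
    then show "xs \<in> ?L \<and> ys \<in> ?L"
      using length_shuffle[OF *] by (auto simp: shuffle_perms_def)
  qed
  show "finite (?L \<times> ?L)" by (intro finite_cartesian_product finite_lists_length_le) auto
qed

lemma shuffle_perms_0: "shuffle_perms 0 = {([], [])}"
  by (auto simp: shuffle_perms_def)

lemma strict_sorted_Suc_list:
  assumes "sorted_wrt (<) xs" "0 \<notin> set xs"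
  obtains ys where "xs = map Suc ys" "sorted_wrt (<) ys"
proof -
  obtain ys where ys: "xs = map Suc ys"
    using assms(2) by (metis ex_map_conv not0_implies_Suc)
  with assms(1) have "sorted_wrt (<) ys" by (simp add: sorted_wrt_map)
  with ys show ?thesis by (rule that)
qed

lemma strict_sorted_0_Suc_list:
  assumes "sorted_wrt (<) xs" "0 \<in> set xs"
  obtains ys where "xs = 0 # map Suc ys" "sorted_wrt (<) ys"
proof -
  obtain x xs' where xs: "xs = x # xs'" using assms(2) by (cases xs) auto
  with assms have "x = 0" "0 \<notin> set xs'" by fastforce+
  with xs assms(1) show ?thesis using strict_sorted_Suc_list[of xs'] that by auto
qed

text \<open>The index \<open>0\<close> of a shuffle comes first in one of the two increasing sequences.\<close>

lemma shuffle_perms_Suc: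
  "shuffle_perms (Suc n) =
     (\<lambda>(is, js). (0 # map Suc is, map Suc js)) ` shuffle_perms n \<union>
     (\<lambda>(is, js). (map Suc is, 0 # map Suc js)) ` shuffle_perms n" (is "?L = ?A \<union> ?B")
proof
  have less: "{..<Suc n} = insert 0 (Suc ` {..<n})" by (rule lessThan_Suc_eq_insert_0)
  show "?A \<union> ?B \<subseteq> ?L"
  proof
    fix p assume "p \<in> ?A \<union> ?B"
    then obtain "is" js where p: "p = (0 # map Suc is, map Suc js) \<or> p = (map Suc is, 0 # map Suc js)"
      and "(is, js) \<in> shuffle_perms n" by auto
    then have ij: "sorted_wrt (<) is" "sorted_wrt (<) js" "set is \<inter> set js = {}"
        "set is \<union> set js = {..<n}"
      by (simp_all add: shuffle_perms_def)
    have "Suc ` set is \<union> Suc ` set js = Suc ` {..<n}" using ij(4) by (simp add: image_Un [symmetric])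
    moreover have "Suc ` set is \<inter> Suc ` set js = {}" using ij(3) by (simp add: image_Int [symmetric])
    moreover have "sorted_wrt (\<lambda>x y. Suc x < Suc y) is" "sorted_wrt (\<lambda>x y. Suc x < Suc y) js"
      using ij(1,2) by simp_all
    ultimately show "p \<in> ?L"
      using p unfolding shuffle_perms_def less by (elim disjE) (simp_all add: sorted_wrt_map)
  qed
  show "?L \<subseteq> ?A \<union> ?B"
  proof
    fix p assume "p \<in> ?L"
    then obtain xs ys where p: "p = (xs, ys)" and xy: "sorted_wrt (<) xs" "sorted_wrt (<) ys"
      "set xs \<inter> set ys = {}" and un: "set xs \<union> set ys = insert 0 (Suc ` {..<n})"
      unfolding shuffle_perms_def less by auto
    from un have "0 \<in> set xs \<union> set ys" by blast
    with xy(3) consider "0 \<in> set xs" "0 \<notin> set ys" | "0 \<notin> set xs" "0 \<in> set ys" by blast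
    then show "p \<in> ?A \<union> ?B"
    proof cases
      case 1
      obtain "is" js where *: "xs = 0 # map Suc is" "sorted_wrt (<) is" "ys = map Suc js" "sorted_wrt (<) js"
        using strict_sorted_0_Suc_list[OF xy(1) 1(1)] strict_sorted_Suc_list[OF xy(2) 1(2)] by metis
      have "Suc ` (set is \<union> set js) = Suc ` {..<n}"
        using un unfolding * by (auto simp: image_Un insert_eq_iff)
      then have "set is \<union> set js = {..<n}" by (simp add: inj_image_eq_iff)
      moreover have "set is \<inter> set js = {}" using xy(3) unfolding * by auto
      ultimately have "(is, js) \<in> shuffle_perms n" using * by (simp add: shuffle_perms_def)
      then show ?thesis unfolding p * by (intro UnI1 rev_image_eqI[of "(is, js)"]) simp_all
    next
      case 2
      obtain "is" js where *: "xs = map Suc is" "sorted_wrt (<) is" "ys = 0 # map Suc js" "sorted_wrt (<) js"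
        using strict_sorted_0_Suc_list[OF xy(2) 2(2)] strict_sorted_Suc_list[OF xy(1) 2(1)] by metis
      have "Suc ` (set is \<union> set js) = Suc ` {..<n}"
        using un unfolding * by (auto simp: image_Un insert_eq_iff)
      then have "set is \<union> set js = {..<n}" by (simp add: inj_image_eq_iff)
      moreover have "set is \<inter> set js = {}" using xy(3) unfolding * by auto
      ultimately have "(is, js) \<in> shuffle_perms n" using * by (simp add: shuffle_perms_def)
      then show ?thesis unfolding p * by (intro UnI2 rev_image_eqI[of "(is, js)"]) simp_all
    qed
  qed
qed

lemma sum_shuffle_perms_Suc:
  fixes f :: "nat list \<Rightarrow> nat list \<Rightarrow> 'v::comm_monoid_add"
  shows "(\<Sum>(is, js)\<in>shuffle_perms (Suc n). f is js) =
    (\<Sum>(is, js)\<in>shuffle_perms n. f (0 # map Suc is) (map Suc js)) +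
    (\<Sum>(is, js)\<in>shuffle_perms n. f (map Suc is) (0 # map Suc js))"
proof -
  have inj: "inj_on (\<lambda>(is, js). (0 # map Suc is, map Suc js)) A"
    "inj_on (\<lambda>(is, js). (map Suc is, 0 # map Suc js)) A" for A
    by (auto simp: inj_on_def inj_map_eq_map)
  show ?thesis
    unfolding shuffle_perms_Suc
    by (subst sum.union_disjoint, simp, simp, force)
      (simp only: sum.reindex[OF inj(1)] sum.reindex[OF inj(2)], simp add: case_prod_unfold)
qed

lemma sum_length_Suc:
  fixes f :: "bit list \<Rightarrow> 'v::comm_monoid_add"
  shows "(\<Sum>ds | length ds = Suc n. f ds) = (\<Sum>d\<in>UNIV. \<Sum>ds | length ds = n. f (d # ds))"
proof -
  have *: "{ds :: bit list. length ds = Suc n} = (\<lambda>(d, ds). d # ds) ` (UNIV \<times> {ds. length ds = n})"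
    by (force simp: length_Suc_conv)
  show ?thesis unfolding *
    by (subst sum.reindex) (auto simp: inj_on_def sum.cartesian_product case_prod_unfold)
qed

lemma finite_length_eq [simp]: "finite {ds :: bit list. length ds = n}"
  using finite_lists_length_eq[of "UNIV :: bit set" n] by simp

lemma sum_list_filter_bit:
  "(of_nat (card {s. s < length xs \<and> P (xs ! s) \<and> ds ! (xs ! s) = 1}) :: bit) =
     (\<Sum>y\<leftarrow>filter P xs. ds ! y)"
proof (induction xs)
  case (Cons x xs)
  let ?S = "{s. s < length xs \<and> P (xs ! s) \<and> ds ! (xs ! s) = 1}"
  have "{s. s < length (x # xs) \<and> P ((x # xs) ! s) \<and> ds ! ((x # xs) ! s) = 1} =
      (if P x \<and> ds ! x = 1 then {0} else {}) \<union> Suc ` ?S"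
    by (auto simp: less_Suc_eq_0_disj)
  moreover have "card ((if P x \<and> ds ! x = 1 then {0} else {}) \<union> Suc ` ?S) =
      (if P x \<and> ds ! x = 1 then 1 else 0) + card ?S"
    by (subst card_Un_disjoint) (auto simp: card_image)
  ultimately show ?case using Cons.IH by (cases "ds ! x") auto
qed simp

text \<open>The inversions of \<open>x # xs\<close> are those of \<open>xs\<close> and those that \<open>x\<close> makes with a later entry.\<close>

lemma koszul_Cons:
  "koszul ds (x # xs) = ds ! x * (\<Sum>y\<leftarrow>filter (\<lambda>y. y < x) xs. ds ! y) + koszul ds xs"
proof -
  let ?T = "\<lambda>xs. {(r, s). r < s \<and> s < length xs \<and> xs ! s < xs ! r \<and> ds ! (xs ! r) = 1 \<and> ds ! (xs ! s) = 1}"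
  let ?S = "{s. s < length xs \<and> xs ! s < x \<and> ds ! (xs ! s) = 1}"
  have fin: "finite (?T xs)"
    by (rule finite_subset[of _ "{..<length xs} \<times> {..<length xs}"]) auto
  have T: "?T (x # xs) = (if ds ! x = 1 then Pair 0 ` Suc ` ?S else {}) \<union> map_prod Suc Suc ` ?T xs"
  proof (intro equalityI subsetI)
    fix p assume "p \<in> ?T (x # xs)"
    then show "p \<in> (if ds ! x = 1 then Pair 0 ` Suc ` ?S else {}) \<union> map_prod Suc Suc ` ?T xs"
      by (cases "fst p"; cases "snd p") (auto simp: image_iff)
  qed (auto split: if_splits)
  have "card (?T (x # xs)) = (if ds ! x = 1 then card ?S else 0) + card (?T xs)"
    unfolding T
    by (subst card_Un_disjoint) (auto simp: card_image inj_on_def fin)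
  then have "(of_nat (card (?T (x # xs))) :: bit) = ds ! x * of_nat (card ?S) + of_nat (card (?T xs))"
    by (cases "ds ! x") auto
  then show ?thesis
    unfolding koszul_def sum_list_filter_bit[of xs "\<lambda>y. y < x"] by simp
qed

lemma koszul_Nil: "koszul ds [] = 0"
  by (simp add: koszul_def)

lemma koszul_map_Suc: "koszul (d # ds) (map Suc xs) = koszul ds xs"
  by (induction xs) (simp_all add: koszul_Nil koszul_Cons filter_map comp_def)

lemma koszul_0_Cons: "koszul (d # ds) (0 # map Suc xs) = koszul ds xs"
  by (simp add: koszul_Cons koszul_map_Suc)

text \<open>An index \<open>0\<close> makes inversions with the entries that precede it.\<close>

lemma koszul_insert_0:
  "koszul (d # ds) (map Suc xs @ 0 # map Suc ys) = koszul ds (xs @ ys) + d * (\<Sum>i\<leftarrow>xs. ds ! i)"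
proof (induction xs)
  case Nil
  then show ?case by (simp add: koszul_0_Cons)
next
  case (Cons x xs)
  let ?S = "\<lambda>zs. \<Sum>y\<leftarrow>filter (\<lambda>y. y < x) zs. ds ! y"
  have arith: "a * (s + (d + t)) + (k + d * u) = a * (s + t) + k + d * (a + u)"
    for a s t k u :: bit
    by (cases d; cases a; cases s; cases t; cases k; cases u) simp_all
  have "koszul (d # ds) (map Suc (x # xs) @ 0 # map Suc ys) =
      ds ! x * (?S xs + (d + ?S ys)) + koszul (d # ds) (map Suc xs @ 0 # map Suc ys)"
    by (simp add: koszul_Cons filter_map comp_def)
  also have "\<dots> = ds ! x * (?S xs + ?S ys) + koszul ds (xs @ ys) + d * (ds ! x + (\<Sum>i\<leftarrow>xs. ds ! i))"
    unfolding Cons.IH by (rule arith)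
  also have "\<dots> = koszul ds ((x # xs) @ ys) + d * (\<Sum>i\<leftarrow>x # xs. ds ! i)"
    by (simp add: koszul_Cons)
  finally show ?case .
qed

section \<open>Multilinear supersymmetric functions\<close>

text \<open>\<open>contract a X\<close> inserts \<open>a\<close> as the first argument of \<open>X\<close>. If \<open>X\<close> has positive arity, then this
  is the bracket of \<open>X\<close> with the element \<open>a\<close> of \<open>W\<^sub>-\<^sub>1(\<Pi>A)\<close>.\<close>

definition contract :: "'a \<Rightarrow> ('a list \<Rightarrow> 'b) \<Rightarrow> 'a list \<Rightarrow> 'b" where
  "contract a X = (\<lambda>as. X (a # as))"

lemma contract_apply [simp]: "contract a X as = X (a # as)"
  by (simp add: contract_def)

lemma contract_add: "contract a (X + Y) = contract a X + contract a Y"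
  and contract_diff: "contract a (X - Z) = contract a X - contract a Z"
  and contract_ksign: "contract a (ksign e Z) = ksign e (contract a Z)"
  for X :: "'a list \<Rightarrow> 'v::ab_group_add"
  by (auto simp: contract_def ksign_def)

text \<open>The part of arity \<open>n\<close> of a function on lists.\<close>

definition arity_part :: "nat \<Rightarrow> ('a list \<Rightarrow> 'b::zero) \<Rightarrow> 'a list \<Rightarrow> 'b" where
  "arity_part n X = (\<lambda>as. if length as = n then X as else 0)"

text \<open>The setting: a unital commutative superalgebra \<open>A\<close>, which is a whole type, over a field of
  characteristic \<open>0\<close>.\<close>

locale comm_superalgebra_char_0 =
  unital_comm_superalgebra scale UNIV par "(*)" 1
  for scale :: "'f::field_char_0 \<Rightarrow> 'a::{ring,monoid_mult} \<Rightarrow> 'a" and par :: "bit \<Rightarrow> 'a set"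
begin

sublocale Pi: superspace scale UNIV "parity_shift par"
  by (rule superspace_parity_shift)

sublocale fun_space: vector_space "fscale scale :: 'f \<Rightarrow> ('a list \<Rightarrow> 'a) \<Rightarrow> 'a list \<Rightarrow> 'a"
  by unfold_locales (auto simp: fscale_def scale_right_distrib scale_left_distrib)

text \<open>\<open>PA d\<close> is the component of parity \<open>d\<close> of \<open>\<Pi>A\<close>, and \<open>pc d\<close> the projection onto it.\<close>

abbreviation PA :: "bit \<Rightarrow> 'a set" where "PA \<equiv> parity_shift par"

abbreviation pc :: "bit \<Rightarrow> 'a \<Rightarrow> 'a" where "pc \<equiv> hcomp (parity_shift par)"

abbreviation "linmap \<equiv> Vector_Spaces.linear scale scale"

lemma linmap_iff:
  "linmap f \<longleftrightarrow> (\<forall>x y. f (x + y) = f x + f y) \<and> (\<forall>c x. f (scale c x) = scale c (f x))"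
  by (simp add: Vector_Spaces.linear_iff vector_space_axioms)

lemma linmap_0: "linmap (\<lambda>x. 0)"
  by (simp add: linmap_iff)

lemma linmap_add: "linmap f \<Longrightarrow> linmap g \<Longrightarrow> linmap (\<lambda>x. f x + g x)"
  by (simp add: linmap_iff scale_right_distrib algebra_simps)

lemma linmap_scale: "linmap f \<Longrightarrow> linmap (\<lambda>x. scale c (f x))"
  by (simp add: linmap_iff scale_right_distrib scale_left_commute)

lemma linmap_ksign: "linmap f \<Longrightarrow> linmap (\<lambda>x. ksign e (f x))"
  by (simp add: linmap_iff ksign_plus scale_ksign)

lemma linmap_sum: "(\<And>i. linmap (f i)) \<Longrightarrow> linmap (\<lambda>x. \<Sum>i\<in>I. f i x)"
  by (simp add: linmap_iff sum.distrib scale_sum_right)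

lemma linmap_comp: "linmap f \<Longrightarrow> linmap g \<Longrightarrow> linmap (\<lambda>x. f (g x))"
  by (simp add: linmap_iff)

lemma linmap_pc: "linmap (pc e)"
  by (simp add: linmap_iff Pi.hcomp_add Pi.hcomp_scale)

lemma linmap_eq_0: "linmap f \<Longrightarrow> f 0 = 0"
  using linmap_iff[of f] by (metis add_cancel_right_left)

lemma linmap_neg: "linmap f \<Longrightarrow> f (- x) = - f x"
  using linmap_iff[of f] linmap_eq_0[of f] by (metis add.right_inverse add_eq_0_iff)

lemma linmap_apply_ksign: "linmap f \<Longrightarrow> f (ksign e x) = ksign e (f x)"
  by (simp add: ksign_def linmap_neg)

lemma scale_times_left: "scale c x * y = scale c (x * y)"
  and scale_times_right: "x * scale c y = scale c (x * y)"
  using mult_scale_left mult_scale_right by auto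

lemma pc_in_PA [simp]: "pc e x \<in> PA e"
  by (simp add: Pi.hcomp_in_par)

lemma pc_sum: "pc 0 x + pc 1 x = x"
  by (simp add: Pi.hcomp_sum)

text \<open>Linearity in each argument on lists of every length. A sum of functions of different arities is
  multilinear in this sense exactly if its part of each arity is.\<close>

definition multilinear :: "('a list \<Rightarrow> 'a) \<Rightarrow> bool" where
  "multilinear X \<longleftrightarrow> (\<forall>as bs. linmap (\<lambda>x. X (as @ x # bs)))"

text \<open>The interchange of two adjacent homogeneous arguments costs the sign of their parities in \<open>\<Pi>A\<close>.\<close>

definition supersymmetric :: "('a list \<Rightarrow> 'a) \<Rightarrow> bool" where
  "supersymmetric X \<longleftrightarrow> (\<forall>as bs x y d e. x \<in> PA d \<longrightarrow> y \<in> PA e \<longrightarrow>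
     X (as @ y # x # bs) = ksign (d * e) (X (as @ x # y # bs)))"

lemma multilinear_linmap: "multilinear X \<Longrightarrow> linmap (\<lambda>x. X (as @ x # bs))"
  by (simp add: multilinear_def)

lemma multilinear_Cons: "multilinear X \<Longrightarrow> linmap (\<lambda>x. X (x # bs))"
  using multilinear_linmap[of X "[]"] by simp

lemma multilinear_add_Cons: "multilinear X \<Longrightarrow> X ((a + b) # as) = X (a # as) + X (b # as)"
  using multilinear_Cons[of X as] by (simp add: linmap_iff)

lemma multilinear_scale_Cons: "multilinear X \<Longrightarrow> X (scale c a # as) = scale c (X (a # as))"
  using multilinear_Cons[of X as] by (simp add: linmap_iff)

lemma multilinear_ksign_Cons: "multilinear X \<Longrightarrow> X (ksign e a # as) = ksign e (X (a # as))"
  using multilinear_Cons[of X as] linmap_apply_ksign by blast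

lemma multilinear_0_Cons [simp]: "multilinear X \<Longrightarrow> X (0 # as) = 0"
  using multilinear_Cons linmap_eq_0 by fastforce

lemma multilinear_contract: "multilinear X \<Longrightarrow> multilinear (contract a X)"
  unfolding multilinear_def contract_apply append_Cons [symmetric] by blast

lemma supersymmetric_contract: "supersymmetric X \<Longrightarrow> supersymmetric (contract a X)"
  unfolding supersymmetric_def contract_apply append_Cons [symmetric] by blast

lemma supersymmetric_swap:
  "supersymmetric X \<Longrightarrow> x \<in> PA d \<Longrightarrow> y \<in> PA e \<Longrightarrow> X (y # x # bs) = ksign (d * e) (X (x # y # bs))"
  unfolding supersymmetric_def by (metis append_Nil)

lemma multilinear_add: "multilinear X \<Longrightarrow> multilinear Y \<Longrightarrow> multilinear (X + Y)"
  and multilinear_scale: "multilinear X \<Longrightarrow> multilinear (fscale scale c X)"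
  and multilinear_zero: "multilinear 0"
  by (auto simp: multilinear_def fscale_def intro: linmap_add linmap_scale linmap_0)

lemma supersymmetricI:
  "(\<And>as bs x y d e. x \<in> PA d \<Longrightarrow> y \<in> PA e \<Longrightarrow>
      X (as @ y # x # bs) = ksign (d * e) (X (as @ x # y # bs))) \<Longrightarrow> supersymmetric X"
  unfolding supersymmetric_def by blast

lemma supersymmetricD:
  "supersymmetric X \<Longrightarrow> x \<in> PA d \<Longrightarrow> y \<in> PA e \<Longrightarrow>
    X (as @ y # x # bs) = ksign (d * e) (X (as @ x # y # bs))"
  unfolding supersymmetric_def by blast

lemma supersymmetric_add:
  assumes "supersymmetric X" "supersymmetric Y" shows "supersymmetric (X + Y)"
proof (rule supersymmetricI)
  fix as bs x y d e assume xy: "x \<in> PA d" "y \<in> PA e"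
  show "(X + Y) (as @ y # x # bs) = ksign (d * e) ((X + Y) (as @ x # y # bs))"
    using supersymmetricD[OF assms(1) xy, of as bs] supersymmetricD[OF assms(2) xy, of as bs]
    by (simp add: ksign_plus)
qed

lemma supersymmetric_scale:
  assumes "supersymmetric X" shows "supersymmetric (fscale scale c X)"
proof (rule supersymmetricI)
  fix as bs x y d e assume xy: "x \<in> PA d" "y \<in> PA e"
  show "fscale scale c X (as @ y # x # bs) = ksign (d * e) (fscale scale c X (as @ x # y # bs))"
    using supersymmetricD[OF assms xy, of as bs] by (simp add: fscale_def scale_ksign)
qed

lemma supersymmetric_zero: "supersymmetric 0"
  by (rule supersymmetricI) simp

text \<open>A multilinear function is determined by its values on lists with homogeneous entries.\<close>

lemma multilinear_eqI:
  assumes X: "multilinear X" and Y: "multilinear Y"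
    and hom: "\<And>as ds. list_all2 (\<lambda>a d. a \<in> PA d) as ds \<Longrightarrow> X as = Y as"
  shows "X = Y"
proof -
  \<comment> \<open>Entries are split into their components one at a time; \<open>bs\<close> collects those already split.\<close>
  have "X (bs @ as) = Y (bs @ as)" if "list_all2 (\<lambda>a d. a \<in> PA d) bs ds" for as bs ds
    using that
  proof (induction as arbitrary: bs ds)
    case Nil
    then show ?case by (simp add: hom)
  next
    case (Cons a as)
    have *: "X (bs @ pc e a # as) = Y (bs @ pc e a # as)" for e
      using Cons.IH[of "bs @ [pc e a]" "ds @ [e]"] Cons.prems by (simp add: list_all2_appendI)
    have "Z (bs @ a # as) = Z (bs @ pc 0 a # as) + Z (bs @ pc 1 a # as)" if "multilinear Z" for Z
      using multilinear_linmap[OF that, of bs as] pc_sum[of a] by (metis (no_types, lifting) linmap_iff)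
    with * X Y show ?case by metis
  qed
  from this[of "[]" "[]"] show ?thesis by (auto intro: ext)
qed

lemma W_hom_iff:
  "X \<in> W_hom scale par k \<longleftrightarrow>
     multilinear X \<and> supersymmetric X \<and> (\<forall>as. int (length as) \<noteq> k + 1 \<longrightarrow> X as = 0)"
proof (cases "k < -1")
  case True
  then have "int (length as) \<noteq> k + 1" for as :: "'a list" by simp
  with True show ?thesis
    by (auto simp: W_hom_def multilinear_zero supersymmetric_zero intro!: ext)
next
  case False
  let ?len = "\<forall>as. int (length as) \<noteq> k + 1 \<longrightarrow> X as = 0"
  have upd: "(as @ z # bs)[length as := y] = as @ y # bs" for as bs and y z :: 'a
    by (simp add: list_update_append)
  have split1: "\<exists>bs a cs. as = bs @ a # cs \<and> length bs = i" if "i < length as" for i and as :: "'a list"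
    using id_take_nth_drop[OF that] that by (intro exI[of _ "take i as"]) auto
  have split2: "\<exists>bs a b cs. as = bs @ a # b # cs \<and> length bs = i" if "Suc i < length as" for i and as :: "'a list"
    using id_take_nth_drop[of i as] Cons_nth_drop_Suc[of "Suc i" as] that
    by (intro exI[of _ "take i as"] exI[of _ "as ! i"] exI[of _ "as ! Suc i"] exI[of _ "drop (Suc (Suc i)) as"]) auto
  have ml: "(\<forall>as i. int (length as) = k + 1 \<longrightarrow> i < length as \<longrightarrow> linmap (\<lambda>x. X (as[i := x])))
      \<longleftrightarrow> multilinear X" if len: ?len
  proof
    assume *: "\<forall>as i. int (length as) = k + 1 \<longrightarrow> i < length as \<longrightarrow> linmap (\<lambda>x. X (as[i := x]))"
    show "multilinear X"
      unfolding multilinear_def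
    proof (intro allI)
      fix as bs
      show "linmap (\<lambda>x. X (as @ x # bs))"
      proof (cases "int (length (as @ 0 # bs)) = k + 1")
        case True
        have "length as < length (as @ 0 # bs)" by simp
        with True * have "linmap (\<lambda>x. X ((as @ 0 # bs)[length as := x]))" by blast
        then show ?thesis by (simp only: upd)
      next
        case False
        with len have "X (as @ x # bs) = 0" for x by simp
        then show ?thesis by (simp add: linmap_0)
      qed
    qed
  next
    assume *: "multilinear X"
    show "\<forall>as i. int (length as) = k + 1 \<longrightarrow> i < length as \<longrightarrow> linmap (\<lambda>x. X (as[i := x]))"
    proof (intro allI impI)
      fix as :: "'a list" and i assume "i < length as"
      then obtain bs a cs where "as = bs @ a # cs" "length bs = i" using split1 by blast
      with * show "linmap (\<lambda>x. X (as[i := x]))" by (auto simp: upd multilinear_linmap)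
    qed
  qed
  have ss: "(\<forall>as i d e. int (length as) = k + 1 \<longrightarrow> Suc i < length as \<longrightarrow>
            as ! i \<in> PA d \<longrightarrow> as ! Suc i \<in> PA e \<longrightarrow>
            X (as[i := as ! Suc i, Suc i := as ! i]) = ksign (d * e) (X as))
      \<longleftrightarrow> supersymmetric X" if len: ?len
  proof
    assume *: "\<forall>as i d e. int (length as) = k + 1 \<longrightarrow> Suc i < length as \<longrightarrow>
            as ! i \<in> PA d \<longrightarrow> as ! Suc i \<in> PA e \<longrightarrow>
            X (as[i := as ! Suc i, Suc i := as ! i]) = ksign (d * e) (X as)"
    show "supersymmetric X"
      unfolding supersymmetric_def
    proof (intro allI impI)
      fix as bs x y d e assume xy: "x \<in> PA d" "y \<in> PA e"
      show "X (as @ y # x # bs) = ksign (d * e) (X (as @ x # y # bs))"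
      proof (cases "int (length (as @ x # y # bs)) = k + 1")
        case True
        let ?l = "as @ x # y # bs"
        have "Suc (length as) < length ?l" "?l ! length as = x" "?l ! Suc (length as) = y"
          by (auto simp: nth_append)
        with True * xy have "X (?l[length as := y, Suc (length as) := x]) = ksign (d * e) (X ?l)"
          by metis
        then show ?thesis by (simp add: list_update_append)
      next
        case False
        with len show ?thesis by simp
      qed
    qed
  next
    assume *: "supersymmetric X"
    show "\<forall>as i d e. int (length as) = k + 1 \<longrightarrow> Suc i < length as \<longrightarrow>
            as ! i \<in> PA d \<longrightarrow> as ! Suc i \<in> PA e \<longrightarrow>
            X (as[i := as ! Suc i, Suc i := as ! i]) = ksign (d * e) (X as)"
    proof (intro allI impI)
      fix as :: "'a list" and i d e
      assume "Suc i < length as" and m: "as ! i \<in> PA d" "as ! Suc i \<in> PA e"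
      then obtain bs a b cs where as: "as = bs @ a # b # cs" "length bs = i" using split2 by blast
      with m have "a \<in> PA d" "b \<in> PA e" by (auto simp: nth_append)
      with * have "X (bs @ b # a # cs) = ksign (d * e) (X (bs @ a # b # cs))"
        by (intro supersymmetricD)
      with as show "X (as[i := as ! Suc i, Suc i := as ! i]) = ksign (d * e) (X as)"
        by (simp add: nth_append list_update_append)
    qed
  qed
  show ?thesis
  proof (cases ?len)
    case True
    show ?thesis using False True ml[OF True] ss[OF True] by (simp add: W_hom_def)
  next
    case F: False
    then show ?thesis using False by (auto simp: W_hom_def)
  qed
qed

text \<open>A subspace that is stable under taking the parts of each arity is spanned by its
  elements of a single arity.\<close>

lemma span_arity_parts:
  assumes sub: "fun_space.subspace U"
    and bounded: "\<And>X. X \<in> U \<Longrightarrow> \<exists>N. \<forall>as. N \<le> length as \<longrightarrow> X as = 0"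
    and part: "\<And>X n. X \<in> U \<Longrightarrow> arity_part n X \<in> U"
  shows "fun_space.span (\<Union>k. {X \<in> U. \<forall>as. int (length as) \<noteq> k + 1 \<longrightarrow> X as = 0}) = U"
proof
  show "fun_space.span (\<Union>k. {X \<in> U. \<forall>as. int (length as) \<noteq> k + 1 \<longrightarrow> X as = 0}) \<subseteq> U"
    by (intro fun_space.span_minimal sub) auto
  show "U \<subseteq> fun_space.span (\<Union>k. {X \<in> U. \<forall>as. int (length as) \<noteq> k + 1 \<longrightarrow> X as = 0})"
  proof
    fix X assume X: "X \<in> U"
    then obtain N where N: "\<And>as. N \<le> length as \<Longrightarrow> X as = 0" using bounded by blast
    have "X = (\<Sum>n<N. arity_part n X)"
    proof
      fix as
      have "(\<Sum>n<N. arity_part n X) as = (\<Sum>n<N. arity_part n X as)"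
        by (induction N) simp_all
      also have "\<dots> = X as"
        using N[of as] by (simp add: arity_part_def not_less)
      finally show "X as = (\<Sum>n<N. arity_part n X) as" ..
    qed
    also have "\<dots> \<in> fun_space.span (\<Union>k. {X \<in> U. \<forall>as. int (length as) \<noteq> k + 1 \<longrightarrow> X as = 0})"
    proof (intro fun_space.span_sum fun_space.span_base)
      fix n
      have "\<forall>as. int (length as) \<noteq> (int n - 1) + 1 \<longrightarrow> arity_part n X as = 0"
        by (simp add: arity_part_def)
      with part[OF X, of n]
      show "arity_part n X \<in> (\<Union>k. {X \<in> U. \<forall>as. int (length as) \<noteq> k + 1 \<longrightarrow> X as = 0})"
        by blast
    qed
    finally show "X \<in> fun_space.span (\<Union>k. {X \<in> U. \<forall>as. int (length as) \<noteq> k + 1 \<longrightarrow> X as = 0})" .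
  qed
qed

lemma multilinear_arity_part: "multilinear X \<Longrightarrow> multilinear (arity_part n X)"
  unfolding multilinear_def
proof (intro allI)
  fix as bs
  assume "\<forall>as bs. linmap (\<lambda>x. X (as @ x # bs))"
  then show "linmap (\<lambda>x. arity_part n X (as @ x # bs))"
    by (cases "Suc (length as + length bs) = n") (simp_all add: arity_part_def linmap_0)
qed

lemma supersymmetric_arity_part:
  assumes "supersymmetric X" shows "supersymmetric (arity_part n X)"
proof (rule supersymmetricI)
  fix as bs x y d e assume xy: "x \<in> PA d" "y \<in> PA e"
  show "arity_part n X (as @ y # x # bs) = ksign (d * e) (arity_part n X (as @ x # y # bs))"
    using supersymmetricD[OF assms xy, of as bs] by (simp add: arity_part_def)
qed

lemma bounded_arity_part: "\<exists>N. \<forall>as. N \<le> length as \<longrightarrow> arity_part n X as = 0"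
  by (intro exI[of _ "Suc n"]) (simp add: arity_part_def)

text \<open>Finite sums of functions of fixed arities are the functions of bounded arity.\<close>

lemma W_iff:
  "X \<in> W scale par \<longleftrightarrow>
     multilinear X \<and> supersymmetric X \<and> (\<exists>N. \<forall>as. N \<le> length as \<longrightarrow> X as = 0)"
proof -
  let ?U = "{X. multilinear X \<and> supersymmetric X \<and> (\<exists>N. \<forall>as. N \<le> length as \<longrightarrow> X as = 0)}"
  have hom: "W_hom scale par k = {X \<in> ?U. \<forall>as. int (length as) \<noteq> k + 1 \<longrightarrow> X as = 0}" for k
  proof -
    have "\<exists>N. \<forall>as. N \<le> length as \<longrightarrow> X as = 0" if "\<forall>as. int (length as) \<noteq> k + 1 \<longrightarrow> X as = 0"
      for X :: "'a list \<Rightarrow> 'a"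
      using that by (intro exI[of _ "nat (k + 2)"]) auto
    then show ?thesis by (auto simp: W_hom_iff)
  qed
  have "fun_space.subspace ?U"
  proof (rule fun_space.subspaceI)
    fix X Y assume XY: "X \<in> ?U" "Y \<in> ?U"
    then obtain M N where "\<forall>as. M \<le> length as \<longrightarrow> X as = 0" "\<forall>as. N \<le> length as \<longrightarrow> Y as = 0"
      by auto
    then have "\<forall>as. max M N \<le> length as \<longrightarrow> (X + Y) as = 0" by simp
    then have "\<exists>N. \<forall>as. N \<le> length as \<longrightarrow> (X + Y) as = 0" by blast
    with XY show "X + Y \<in> ?U" by (simp add: multilinear_add supersymmetric_add del: plus_fun_apply)
  next
    fix c X assume "X \<in> ?U"
    moreover have "fscale scale c X as = 0" if "X as = 0" for as
      using that by (simp add: fscale_def)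
    ultimately show "fscale scale c X \<in> ?U"
      by (auto simp: multilinear_scale supersymmetric_scale)
  qed (auto simp: multilinear_zero supersymmetric_zero)
  moreover have "arity_part n X \<in> ?U" if "X \<in> ?U" for n X
    using that by (simp add: multilinear_arity_part supersymmetric_arity_part bounded_arity_part)
  ultimately have "fun_space.span (\<Union>k. {X \<in> ?U. \<forall>as. int (length as) \<noteq> k + 1 \<longrightarrow> X as = 0}) = ?U"
    by (intro span_arity_parts) auto
  then have "W scale par = ?U" unfolding W_def hom[symmetric] .
  then show ?thesis by blast
qed

text \<open>\<open>W(\<Pi>A)\<close> and its component of a given parity.\<close>

abbreviation "WW \<equiv> W scale par"
abbreviation "Wp \<equiv> W_par scale par"

lemma W_multilinear: "X \<in> WW \<Longrightarrow> multilinear X"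
  and W_supersymmetric: "X \<in> WW \<Longrightarrow> supersymmetric X"
  by (simp_all add: W_iff)

lemma W_subspace: "fun_space.subspace WW"
  by (simp add: W_def)

lemma W_hom_subset: "W_hom scale par k \<subseteq> WW"
  unfolding W_def using fun_space.span_base by blast

lemma W_arity_part: "X \<in> WW \<Longrightarrow> arity_part n X \<in> WW"
  by (simp add: W_iff multilinear_arity_part supersymmetric_arity_part bounded_arity_part)

lemma W_contract: assumes "X \<in> WW" shows "contract a X \<in> WW"
proof -
  obtain N where "\<forall>as. N \<le> length as \<longrightarrow> X as = 0" using assms by (auto simp: W_iff)
  then have "\<forall>as. N \<le> length as \<longrightarrow> contract a X as = 0" by simp
  with assms show ?thesis
    by (auto simp: W_iff multilinear_contract supersymmetric_contract simp del: contract_apply)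
qed


section \<open>The parity of functions\<close>

text \<open>The parity automorphism of \<open>\<Pi>A\<close> and the one that it induces on \<open>W(\<Pi>A)\<close>.\<close>

definition flip :: "'a \<Rightarrow> 'a" where
  "flip a = pc 0 a - pc 1 a"

definition Wflip :: "('a list \<Rightarrow> 'a) \<Rightarrow> 'a list \<Rightarrow> 'a" where
  "Wflip X = (\<lambda>as. flip (X (map flip as)))"

lemma linmap_flip: "linmap flip"
proof -
  have "flip = (\<lambda>a. pc 0 a + scale (-1) (pc 1 a))"
    by (rule ext) (simp add: flip_def)
  then show ?thesis by (simp only: linmap_add linmap_scale linmap_pc)
qed

lemma flip_homogeneous: "a \<in> PA d \<Longrightarrow> flip a = ksign d a"
  by (cases d) (simp_all add: flip_def Pi.hcomp_homogeneous)

lemma flip_in_PA: "a \<in> PA d \<Longrightarrow> flip a \<in> PA d"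
  by (simp add: flip_homogeneous Pi.ksign_in_par)

lemma W_Wflip: assumes "X \<in> WW" shows "Wflip X \<in> WW"
proof -
  obtain N where "\<forall>as. N \<le> length as \<longrightarrow> X as = 0" using assms by (auto simp: W_iff)
  then have "\<forall>as. N \<le> length as \<longrightarrow> Wflip X as = 0" 
    by (simp add: Wflip_def linmap_eq_0[OF linmap_flip])
  moreover have "multilinear (Wflip X)"
    unfolding multilinear_def Wflip_def
  proof (intro allI)
    fix as bs
    have "linmap (\<lambda>x. flip (X (map flip as @ flip x # map flip bs)))"
      using linmap_comp[OF linmap_flip linmap_comp[OF multilinear_linmap[OF W_multilinear[OF assms], of "map flip as" "map flip bs"] linmap_flip]] .
    then show "linmap (\<lambda>x. flip (X (map flip (as @ x # bs))))" by simp
  qed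
  moreover have "supersymmetric (Wflip X)"
  proof (rule supersymmetricI)
    fix as bs x y d e assume xy: "x \<in> PA d" "y \<in> PA e"
    show "Wflip X (as @ y # x # bs) = ksign (d * e) (Wflip X (as @ x # y # bs))"
      using supersymmetricD[OF W_supersymmetric[OF assms] flip_in_PA[OF xy(1)] flip_in_PA[OF xy(2)],
          of "map flip as" "map flip bs"]
      by (simp add: Wflip_def linmap_apply_ksign[OF linmap_flip])
  qed
  ultimately show ?thesis by (auto simp: W_iff)
qed

lemma multilinear_map_flip:
  assumes "multilinear X" "list_all2 (\<lambda>a d. a \<in> PA d) as ds"
  shows "X (map flip as) = ksign (sum_list ds) (X as)"
  using assms(2,1)
proof (induction as ds arbitrary: X rule: list_all2_induct)
  case (Cons a as d ds)
  have "X (map flip (a # as)) = ksign d (X (a # map flip as))"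
    using Cons by (simp add: flip_homogeneous multilinear_ksign_Cons)
  also have "X (a # map flip as) = ksign (sum_list ds) (X (a # as))"
    using Cons.IH[OF multilinear_contract[OF Cons.prems, of a]] by simp
  finally show ?case by simp
qed simp

lemma half_add: "scale (1/2) (x + x) = x"
proof -
  have "scale (1/2) (x + x) = scale (1/2 + 1/2) x" by (simp only: scale_right_distrib scale_left_distrib)
  then show ?thesis by simp
qed

text \<open>The components of \<open>X\<close> are its projections onto the eigenspaces of the involution \<open>Wflip\<close>; this
  is where a characteristic other than \<open>2\<close> is used.\<close>

lemma Wflip_half_in_Wp:
  assumes "X \<in> WW"
  shows "fscale scale (1/2) (X + ksign e (Wflip X)) \<in> Wp e"
  unfolding W_par_def
proof (intro CollectI conjI allI impI)
  have "ksign e (Wflip X) \<in> WW" by (intro fun_space.subspace_ksign W_subspace W_Wflip assms)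
  then show "fscale scale (1/2) (X + ksign e (Wflip X)) \<in> WW"
    using assms W_subspace by (simp add: fun_space.subspace_add fun_space.subspace_scale)
next
  fix as ds assume hom: "list_all2 (\<lambda>a d. a \<in> PA d) as ds"
  let ?v = "X as" and ?s = "sum_list ds"
  have flip: "Wflip X as = ksign ?s (flip ?v)"
    using multilinear_map_flip[OF W_multilinear[OF assms] hom]
    by (simp add: Wflip_def linmap_apply_ksign[OF linmap_flip])
  have "fscale scale (1/2) (X + ksign e (Wflip X)) as = scale (1/2) (?v + ksign (e + ?s) (flip ?v))"
    by (simp add: fscale_def ksign_apply flip)
  also have "\<dots> = pc (e + ?s) ?v"
  proof -
    have eigen: "w + ksign f (a - b) = (if f = 0 then a else b) + (if f = 0 then a else b)"
      if "a + b = w" for w a b :: 'a and f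
      by (cases f) (simp_all add: that[symmetric])
    have component: "(if f = 0 then pc 0 ?v else pc 1 ?v) = pc f ?v" for f
      by (cases f) simp_all
    have "?v + ksign f (flip ?v) = pc f ?v + pc f ?v" for f
      unfolding flip_def eigen[OF pc_sum] component ..
    then show ?thesis by (simp add: half_add)
  qed
  also have "\<dots> \<in> PA (e + ?s)" by simp
  finally show "fscale scale (1/2) (X + ksign e (Wflip X)) as \<in> PA (e + ?s)" .
qed

lemma W_par_subspace: "fun_space.subspace (Wp e)"
  using W_subspace Pi.par_subspace
  by (auto simp: W_par_def fscale_def fun_space.subspace_def subspace_def)

lemma W_par_disjoint:
  assumes "X \<in> Wp 0" "X \<in> Wp 1" shows "X = 0"
proof (rule multilinear_eqI)
  show "multilinear X" using assms by (simp add: W_par_def W_multilinear)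
  show "X as = 0 as" if "list_all2 (\<lambda>a d. a \<in> PA d) as ds" for as ds
    using assms that Pi.par_disjoint[of "X as" "sum_list ds"] by (auto simp: W_par_def add.commute)
qed (rule multilinear_zero)

text \<open>A subspace of \<open>W(\<Pi>A)\<close> that is stable under the involution is graded by parity. The shift \<open>c\<close>
  allows for the parities of \<open>W(\<Pi>A)\<close> and of \<open>\<Pi>W(\<Pi>A)\<close> alike.\<close>

lemma parity_direct_sum:
  assumes sub: "fun_space.subspace U" "U \<subseteq> WW" and flip: "\<And>X. X \<in> U \<Longrightarrow> Wflip X \<in> U"
  shows "fun_space.internal_direct_sum (\<lambda>e. U \<inter> Wp (e + c)) U"
proof (rule fun_space.internal_direct_sum_bitI)
  fix X assume X: "X \<in> U"
  let ?h = "\<lambda>e. fscale scale (1/2) (X + ksign (e + c) (Wflip X))"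
  have h: "?h e \<in> U \<inter> Wp (e + c)" for e
  proof
    show "?h e \<in> U"
      by (intro fun_space.subspace_scale[OF sub(1)] fun_space.subspace_add[OF sub(1)]
          fun_space.subspace_ksign[OF sub(1)] X flip)
    show "?h e \<in> Wp (e + c)" using X sub(2) by (intro Wflip_half_in_Wp) auto
  qed
  have "X = ?h 0 + ?h 1"
  proof
    fix as
    have "scale (1/2) (X as) + scale (1/2) (X as) = X as"
      using half_add[of "X as"] by (simp add: scale_right_distrib)
    then show "X as = (?h 0 + ?h 1) as"
      by (cases c) (simp_all add: fscale_def scale_right_distrib scale_right_diff_distrib)
  qed
  with h[of 0] h[of 1] show "\<exists>Y\<in>U \<inter> Wp (0 + c). \<exists>Z\<in>U \<inter> Wp (1 + c). X = Y + Z" by blast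
next
  show "U \<inter> Wp (0 + c) \<inter> (U \<inter> Wp (1 + c)) = {0}"
    using W_par_disjoint fun_space.subspace_0 sub(1) W_par_subspace
    by (cases c) (auto simp: fun_space.subspace_0)
qed (use sub W_par_subspace in \<open>auto intro: fun_space.subspace_inter\<close>)

sublocale WS: superspace "fscale scale" WW Wp
proof (unfold_locales)
  have "Wp = (\<lambda>e. WW \<inter> Wp (e + 0))" by (auto simp: W_par_def)
  moreover have "fun_space.internal_direct_sum (\<lambda>e. WW \<inter> Wp (e + 0)) WW"
    by (rule parity_direct_sum) (simp_all add: W_subspace W_Wflip)
  ultimately show "fun_space.internal_direct_sum Wp WW" by simp
qed

lemma Wp_subset: "X \<in> Wp e \<Longrightarrow> X \<in> WW"
  by (simp add: W_par_def)

lemma Wp_contract: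
  assumes "X \<in> Wp e" "a \<in> PA d" shows "contract a X \<in> Wp (e + d)"
  unfolding W_par_def
proof (intro CollectI conjI allI impI)
  show "contract a X \<in> WW" using assms by (simp add: Wp_subset W_contract)
  fix as ds assume "list_all2 (\<lambda>a d. a \<in> PA d) as ds"
  then have "list_all2 (\<lambda>a d. a \<in> PA d) (a # as) (d # ds)" using assms by simp
  moreover have "\<forall>as ds. list_all2 (\<lambda>a d. a \<in> PA d) as ds \<longrightarrow> X as \<in> PA (e + sum_list ds)"
    using assms by (simp add: W_par_def)
  ultimately have "X (a # as) \<in> PA (e + sum_list (d # ds))" by blast
  then show "contract a X as \<in> PA (e + d + sum_list ds)"
    by (simp only: contract_apply sum_list.Cons add.assoc)
qed

lemma Wp_apply:
  "X \<in> Wp e \<Longrightarrow> list_all2 (\<lambda>a d. a \<in> PA d) as ds \<Longrightarrow> X as \<in> PA (e + sum_list ds)"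
  by (simp add: W_par_def)

lemma Wp_apply_Nil: "X \<in> Wp e \<Longrightarrow> X [] \<in> PA e"
  using Wp_apply[of X e "[]" "[]"] by simp


section \<open>Contractions and the box product\<close>

text \<open>\<open>bx X Y\<close> stands for \<open>X \<box> Y\<close>.\<close>

abbreviation "bx \<equiv> box par"

lemma hcomps_Cons: "hcomps par (d # ds) (a # as) = pc d a # hcomps par ds as"
  by (simp add: hcomps_def)

lemma map_nth_map_Suc: "map ((!) (x # xs)) (map Suc is) = map ((!) xs) is"
  by simp

lemma hcomps_homogeneous:
  assumes "length ds = length as" "set is \<subseteq> {..<length as}"
  shows "list_all2 (\<lambda>a d. a \<in> PA d) (map ((!) (hcomps par ds as)) is) (map ((!) ds) is)"
  using assms by (auto simp: list_all2_conv_all_nth hcomps_def subset_iff)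

lemma shuffle_perms_subset: "(is, js) \<in> shuffle_perms n \<Longrightarrow> set is \<subseteq> {..<n}"
  by (auto simp: shuffle_perms_def)

lemma contract_zero: "multilinear X \<Longrightarrow> contract 0 X = 0"
  by (rule ext) simp

lemma contract_add_arg: "multilinear X \<Longrightarrow> contract (a + b) X = contract a X + contract b X"
  by (rule ext) (simp add: multilinear_add_Cons)

lemma contract_scale_arg: "multilinear X \<Longrightarrow> contract (scale c a) X = fscale scale c (contract a X)"
  by (rule ext) (simp add: multilinear_scale_Cons fscale_def)

text \<open>Contractions supercommute: this is supersymmetry in the first two arguments.\<close>

lemma contract_swap:
  assumes "supersymmetric X" "x \<in> PA d" "y \<in> PA e"
  shows "contract x (contract y X) = ksign (d * e) (contract y (contract x X))"
  by (rule ext) (simp add: ksign_apply supersymmetric_swap[OF assms(1,2,3)])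

lemma fscale_minus_one: "fscale scale (- 1) X = - X"
  by (rule ext) (simp add: fscale_def)

lemma box_Nil: "bx X Y [] = X [Y []]"
  by (simp add: box_def shuffle_perms_0 koszul_Nil)

text \<open>The shuffles are sorted by the sequence that contains the index \<open>0\<close>. If it is the first one,
  then \<open>a\<close> is the first argument of \<open>Y\<close>. If it is the second one, then \<open>a\<close> follows \<open>Y(\<dots>)\<close> among the
  arguments of \<open>X\<close>; the sign for interchanging the two and the Koszul sign for moving \<open>a\<close> past the
  arguments of \<open>Y\<close> leave the sign of \<open>a\<close> and \<open>Y\<close>.\<close>

lemma box_Cons:
  assumes X: "X \<in> WW" and Y: "Y \<in> Wp e"
  shows "bx X Y (a # as) =
    (\<Sum>d\<in>UNIV. bx X (contract (pc d a) Y) as + ksign (d * e) (bx (contract (pc d a) X) Y as))"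
proof -
  define T where "T X Y ds as is js = ksign (koszul ds (is @ js))
      (X (Y (map ((!) (hcomps par ds as)) is) # map ((!) (hcomps par ds as)) js))"
    for X Y :: "'a list \<Rightarrow> 'a" and ds as "is" js
  have bx: "bx X Y as = (\<Sum>ds | length ds = length as. \<Sum>(is, js)\<in>shuffle_perms (length as). T X Y ds as is js)"
    for X Y as by (simp add: box_def T_def Let_def)
  have T1: "T X Y (d # ds) (a # as) (0 # map Suc is) (map Suc js) =
      T X (contract (pc d a) Y) ds as is js" for d ds "is" js
  proof -
    have "koszul (d # ds) ((0 # map Suc is) @ map Suc js) = koszul ds (is @ js)"
      using koszul_0_Cons[of d ds "is @ js"] by simp
    then show ?thesis unfolding T_def hcomps_Cons list.map(2) map_nth_map_Suc by simp
  qed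
  have T2: "T X Y (d # ds) (a # as) (map Suc is) (0 # map Suc js) =
      ksign (d * e) (T (contract (pc d a) X) Y ds as is js)"
    if "(is, js) \<in> shuffle_perms (length as)" "length ds = length as" for d ds "is" js
  proof -
    let ?b = "(!) (hcomps par ds as)" and ?s = "\<Sum>i\<leftarrow>is. ds ! i"
    have "Y (map ?b is) \<in> PA (e + ?s)"
      using Y hcomps_homogeneous[OF that(2) shuffle_perms_subset[OF that(1)]] by (rule Wp_apply)
    then have swap: "X (Y (map ?b is) # pc d a # map ?b js) =
        ksign (d * (e + ?s)) (X (pc d a # Y (map ?b is) # map ?b js))"
      by (intro supersymmetric_swap W_supersymmetric X pc_in_PA)
    have sign: "koszul ds (is @ js) + d * ?s + d * (e + ?s) = d * e + koszul ds (is @ js)"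
      by (cases d; cases ?s) (simp_all add: add_ac)
    show ?thesis
      unfolding T_def hcomps_Cons list.map(2) map_nth_map_Suc koszul_insert_0 nth_Cons_0
        contract_apply swap ksign_ksign sign ..
  qed
  have "bx X Y (a # as) = (\<Sum>d\<in>UNIV. \<Sum>ds | length ds = length as.
      (\<Sum>(is, js)\<in>shuffle_perms (length as). T X (contract (pc d a) Y) ds as is js) +
      (\<Sum>(is, js)\<in>shuffle_perms (length as). ksign (d * e) (T (contract (pc d a) X) Y ds as is js)))"
    unfolding bx list.size(4) add_0_right add_Suc_right sum_length_Suc sum_shuffle_perms_Suc
    by (intro sum.cong refl arg_cong2[where f = "(+)"]) (auto simp: T1 T2)
  also have "\<dots> = (\<Sum>d\<in>UNIV. bx X (contract (pc d a) Y) as + ksign (d * e) (bx (contract (pc d a) X) Y as))"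
    unfolding bx sum.distrib ksign_sum by (simp add: case_prod_unfold Let_def)
  finally show ?thesis .
qed

lemma box_add_left: "bx (X1 + X2) Y = bx X1 Y + bx X2 Y"
  by (rule ext) (simp add: box_def ksign_plus sum.distrib case_prod_unfold Let_def)

lemma box_scale_left: "bx (fscale scale c X) Y = fscale scale c (bx X Y)"
  by (rule ext) (simp add: box_def fscale_def scale_ksign[symmetric] scale_sum_right case_prod_unfold Let_def)

lemma box_add_right: "multilinear X \<Longrightarrow> bx X (Y1 + Y2) = bx X Y1 + bx X Y2"
  by (rule ext) (simp add: box_def ksign_plus sum.distrib case_prod_unfold Let_def multilinear_add_Cons)

lemma box_scale_right: "multilinear X \<Longrightarrow> bx X (fscale scale c Y) = fscale scale c (bx X Y)"
  by (rule ext) (simp add: box_def fscale_def scale_ksign[symmetric] scale_sum_right case_prod_unfold Let_def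
      multilinear_scale_Cons)

lemma box_ksign_left: "bx (ksign e X) Y = ksign e (bx X Y)"
  using box_scale_left[of "-1" X Y] by (simp add: ksign_def fscale_minus_one)

lemma box_ksign_right: "multilinear X \<Longrightarrow> bx X (ksign e Y) = ksign e (bx X Y)"
  using box_scale_right[of X "-1" Y] by (simp add: ksign_def fscale_minus_one)

lemma box_0_left [simp]: "bx 0 Y = 0"
  using box_add_left[of 0 0 Y] by simp

lemma box_0_right: "multilinear X \<Longrightarrow> bx X 0 = 0"
  using box_add_right[of X 0 0] by simp

lemma contract_box:
  assumes X: "X \<in> WW" and Y: "Y \<in> Wp e" and a: "a \<in> PA d"
  shows "contract a (bx X Y) = bx X (contract a Y) + ksign (d * e) (bx (contract a X) Y)"
proof
  fix as
  have Y': "multilinear Y" using Y by (simp add: Wp_subset W_multilinear)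
  have X': "multilinear X" using X by (simp add: W_multilinear)
  show "contract a (bx X Y) as = (bx X (contract a Y) + ksign (d * e) (bx (contract a X) Y)) as"
    using box_Cons[OF X Y, of a as] Pi.hcomp_homogeneous[OF a]
    by (cases d) (simp_all add: sum_UNIV_bit contract_zero X' Y' box_0_right ksign_apply)
qed

text \<open>A summand in which \<open>i\<close> arguments go to \<open>Y\<close> and \<open>j\<close> go directly to \<open>X\<close> evaluates \<open>X\<close> at \<open>j + 1\<close>
  arguments.\<close>

lemma box_eq_0:
  assumes X: "multilinear X"
    and "\<And>i j. i + j = length as \<Longrightarrow>
      (\<forall>bs. length bs = i \<longrightarrow> Y bs = 0) \<or> (\<forall>bs. length bs = Suc j \<longrightarrow> X bs = 0)"
  shows "bx X Y as = 0"
proof -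
  have "X (Y (map b is) # map b js) = 0" if "(is, js) \<in> shuffle_perms (length as)" for b "is" js
    using assms(2)[OF length_shuffle[OF that]] X by auto
  then show ?thesis unfolding box_def Let_def by (intro sum.neutral ballI) auto
qed

lemma box_multilinear:
  assumes "X \<in> WW" "Y \<in> Wp e" shows "multilinear (bx X Y)"
proof -
  have "linmap (\<lambda>x. bx X Y (bs @ x # as))" for bs as
    using assms
  proof (induction bs arbitrary: X Y e)
    case Nil
    have X: "multilinear X" and Y: "multilinear Y"
      using Nil by (simp_all add: Wp_subset W_multilinear)
    have "linmap (\<lambda>x. bx X (contract x Y) as)"
      by (simp add: linmap_iff contract_add_arg contract_scale_arg X Y box_add_right box_scale_right)
        (simp add: fscale_def)
    moreover have "linmap (\<lambda>x. bx (contract x X) Y as)"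
      by (simp add: linmap_iff contract_add_arg contract_scale_arg X box_add_left box_scale_left)
        (simp add: fscale_def)
    ultimately show ?case
      unfolding append_Nil box_Cons[OF Nil]
      by (intro linmap_sum linmap_add linmap_ksign) (auto intro: linmap_comp linmap_pc)
  next
    case (Cons b bs)
    have "linmap (\<lambda>x. bx X (contract (pc d b) Y) (bs @ x # as))" for d
      using Cons.IH[OF Cons.prems(1) Wp_contract[OF Cons.prems(2) pc_in_PA]] .
    moreover have "linmap (\<lambda>x. bx (contract (pc d b) X) Y (bs @ x # as))" for d
      using Cons.IH[OF W_contract[OF Cons.prems(1)] Cons.prems(2)] .
    ultimately show ?case
      unfolding append_Cons box_Cons[OF Cons.prems]
      by (intro linmap_sum linmap_add linmap_ksign)
  qed
  then show ?thesis by (simp add: multilinear_def)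
qed

lemma box_supersymmetric:
  assumes "X \<in> WW" "Y \<in> Wp e" shows "supersymmetric (bx X Y)"
proof (rule supersymmetricI)
  fix bs as x y d f assume xy: "x \<in> PA d" "y \<in> PA f"
  show "bx X Y (bs @ y # x # as) = ksign (d * f) (bx X Y (bs @ x # y # as))"
    using assms
  proof (induction bs arbitrary: X Y e)
    case (Nil X Y)
    have X: "multilinear X" "supersymmetric X" and Y: "supersymmetric Y"
      using Nil by (simp_all add: Wp_subset W_multilinear W_supersymmetric)
    have twice: "contract v (contract u (bx X Y)) =
        bx X (contract v (contract u Y)) + ksign (g * (e + h)) (bx (contract v X) (contract u Y))
        + ksign (h * e) (bx (contract u X) (contract v Y) + ksign (g * e) (bx (contract v (contract u X)) Y))"
      if u: "u \<in> PA h" and v: "v \<in> PA g" for u v g h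
      unfolding contract_box[OF Nil u] contract_add contract_ksign
        contract_box[OF Nil(1) Wp_contract[OF Nil(2) u] v]
        contract_box[OF W_contract[OF Nil(1)] Nil(2) v] ..
    have "contract x (contract y (bx X Y)) as = ksign (d * f) (contract y (contract x (bx X Y)) as)"
      unfolding twice[OF xy] twice[OF xy(2,1)] contract_swap[OF X(2) xy] contract_swap[OF Y xy]
        box_ksign_right[OF X(1)] box_ksign_left plus_fun_apply ksign_apply
      by (cases d; cases e; cases f) (simp_all add: algebra_simps)
    then show ?case by simp
  next
    case (Cons b bs)
    show ?case
      unfolding append_Cons box_Cons[OF Cons.prems] ksign_sum ksign_plus
        Cons.IH[OF Cons.prems(1) Wp_contract[OF Cons.prems(2) pc_in_PA]]
        Cons.IH[OF W_contract[OF Cons.prems(1)] Cons.prems(2)]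
      by (simp add: add_ac)
  qed
qed

lemma box_in_PA:
  assumes "X \<in> Wp d" "Y \<in> Wp e" "list_all2 (\<lambda>a d. a \<in> PA d) as ds"
  shows "bx X Y as \<in> PA (d + e + sum_list ds)"
  using assms(3,1,2)
proof (induction as ds arbitrary: X Y d e rule: list_all2_induct)
  case Nil
  then have "Y [] \<in> PA e" by (simp add: Wp_apply_Nil)
  with Nil have "X [Y []] \<in> PA (d + sum_list [e])" by (intro Wp_apply) simp_all
  then show ?case by (simp add: box_Nil)
next
  case (Cons a as f ds)
  have "bx X Y (a # as) = bx X (contract a Y) as + ksign (f * e) (bx (contract a X) Y as)"
    using fun_cong[OF contract_box[OF Wp_subset[OF Cons.prems(1)] Cons.prems(2) Cons.hyps(1)], of as]
    by (simp add: ksign_apply)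
  moreover have "bx X (contract a Y) as \<in> PA (d + (e + f) + sum_list ds)"
    using Cons.IH Cons.prems Wp_contract[OF _ Cons.hyps(1)] by blast
  moreover have "bx (contract a X) Y as \<in> PA (d + f + e + sum_list ds)"
    using Cons.IH Cons.prems Wp_contract[OF _ Cons.hyps(1)] by blast
  ultimately show ?case
    by (simp add: Pi.ksign_in_par subspace_add[OF Pi.par_subspace] add_ac)
qed

lemma box_in_Wp: assumes "X \<in> Wp d" "Y \<in> Wp e" shows "bx X Y \<in> Wp (d + e)"
proof -
  have X: "X \<in> WW" and Y: "Y \<in> WW" using assms by (simp_all add: Wp_subset)
  obtain M N where MN: "\<And>as. M \<le> length as \<Longrightarrow> X as = 0" "\<And>as. N \<le> length as \<Longrightarrow> Y as = 0"
    using X Y unfolding W_iff by blast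
  have "\<forall>as. M + N \<le> length as \<longrightarrow> bx X Y as = 0"
  proof (intro allI impI box_eq_0 W_multilinear X)
    fix as :: "'a list" and i j assume "M + N \<le> length as" "i + j = length as"
    then have "N \<le> i \<or> M \<le> Suc j" by linarith
    then show "(\<forall>bs. length bs = i \<longrightarrow> Y bs = 0) \<or> (\<forall>bs. length bs = Suc j \<longrightarrow> X bs = 0)"
      using MN by auto
  qed
  then have "bx X Y \<in> WW"
    using box_multilinear[OF X assms(2)] box_supersymmetric[OF X assms(2)] by (auto simp: W_iff)
  then show ?thesis using box_in_PA[OF assms] by (simp add: W_par_def)
qed


section \<open>The bracket\<close>

text \<open>\<open>WB X Y\<close> stands for \<open>[X, Y]\<close>.\<close>

abbreviation "WB \<equiv> W_bracket scale par"

lemma bracket_homogeneous: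
  assumes "X \<in> Wp d" "Y \<in> Wp e"
  shows "WB X Y = bx X Y - ksign (d * e) (bx Y X)"
proof -
  have "multilinear X" "multilinear Y" using assms by (simp_all add: Wp_subset W_multilinear)
  then show ?thesis
    unfolding W_bracket_def Let_def
    by (cases d; cases e)
      (simp_all add: sum_UNIV_bit WS.hcomp_homogeneous[OF assms(1)] WS.hcomp_homogeneous[OF assms(2)]
        box_0_right)
qed

lemma hcomp_W_multilinear: "X \<in> WW \<Longrightarrow> multilinear (hcomp Wp e X)"
  using WS.hcomp_in_par Wp_subset W_multilinear by blast

lemma bracket_add_left:
  "X1 \<in> WW \<Longrightarrow> X2 \<in> WW \<Longrightarrow> Y \<in> WW \<Longrightarrow> WB (X1 + X2) Y = WB X1 Y + WB X2 Y"
  unfolding W_bracket_def Let_def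
  by (simp add: sum_UNIV_bit WS.hcomp_add box_add_left box_add_right hcomp_W_multilinear algebra_simps)

lemma bracket_add_right:
  "X \<in> WW \<Longrightarrow> Y1 \<in> WW \<Longrightarrow> Y2 \<in> WW \<Longrightarrow> WB X (Y1 + Y2) = WB X Y1 + WB X Y2"
  unfolding W_bracket_def Let_def
  by (simp add: sum_UNIV_bit WS.hcomp_add box_add_left box_add_right hcomp_W_multilinear algebra_simps)

lemma bracket_scale_left:
  "X \<in> WW \<Longrightarrow> Y \<in> WW \<Longrightarrow> WB (fscale scale c X) Y = fscale scale c (WB X Y)"
  unfolding W_bracket_def Let_def
  by (simp add: sum_UNIV_bit WS.hcomp_scale box_scale_left box_scale_right hcomp_W_multilinear
      fun_space.scale_right_distrib fun_space.scale_right_diff_distrib)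

lemma bracket_scale_right:
  "X \<in> WW \<Longrightarrow> Y \<in> WW \<Longrightarrow> WB X (fscale scale c Y) = fscale scale c (WB X Y)"
  unfolding W_bracket_def Let_def
  by (simp add: sum_UNIV_bit WS.hcomp_scale box_scale_left box_scale_right hcomp_W_multilinear
      fun_space.scale_right_distrib fun_space.scale_right_diff_distrib)

lemma bracket_ksign_left: "X \<in> WW \<Longrightarrow> Y \<in> WW \<Longrightarrow> WB (ksign e X) Y = ksign e (WB X Y)"
  using bracket_scale_left[of X Y "-1"] by (simp add: ksign_def fscale_minus_one)

lemma bracket_ksign_right: "X \<in> WW \<Longrightarrow> Y \<in> WW \<Longrightarrow> WB X (ksign e Y) = ksign e (WB X Y)"
  using bracket_scale_right[of X Y "-1"] by (simp add: ksign_def fscale_minus_one)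

lemma bracket_0_left: "Y \<in> WW \<Longrightarrow> WB 0 Y = 0"
  using bracket_add_left[of 0 0 Y] fun_space.subspace_0[OF W_subspace] by simp

lemma bracket_in_Wp:
  assumes "X \<in> Wp d" "Y \<in> Wp e" shows "WB X Y \<in> Wp (d + e)"
  unfolding bracket_homogeneous[OF assms]
  using box_in_Wp[OF assms] box_in_Wp[OF assms(2,1)]
  by (simp add: add.commute fun_space.subspace_diff[OF W_par_subspace] WS.ksign_in_par)

lemma bracket_in_W:
  assumes "X \<in> WW" "Y \<in> WW" shows "WB X Y \<in> WW"
  using assms
proof (induction X rule: WS.homogeneous_induct)
  case (add X1 X2)
  then show ?case
    by (simp add: bracket_add_left fun_space.subspace_add[OF W_subspace] del: plus_fun_apply)
next
  case (homogeneous d X)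
  from homogeneous(2) show ?case
  proof (induction Y rule: WS.homogeneous_induct)
    case (add Y1 Y2)
    with homogeneous(1) show ?case
      by (simp add: Wp_subset bracket_add_right fun_space.subspace_add[OF W_subspace]
          del: plus_fun_apply)
  next
    case (homogeneous e Y)
    with \<open>X \<in> Wp d\<close> show ?case using bracket_in_Wp Wp_subset by blast
  qed
qed

text \<open>Contraction is a superderivation of the bracket: the two summands of the contraction of \<open>X \<box> Y\<close>
  pair up with those for \<open>Y \<box> X\<close>.\<close>

lemma contract_bracket_homogeneous:
  assumes X: "X \<in> Wp d" and Y: "Y \<in> Wp e" and a: "a \<in> PA f"
  shows "contract a (WB X Y) = WB X (contract a Y) + ksign (f * e) (WB (contract a X) Y)"
  unfolding bracket_homogeneous[OF X Y] bracket_homogeneous[OF X Wp_contract[OF Y a]]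
    bracket_homogeneous[OF Wp_contract[OF X a] Y] contract_diff contract_ksign
    contract_box[OF Wp_subset[OF X] Y a] contract_box[OF Wp_subset[OF Y] X a]
  by (cases d; cases e; cases f) (simp_all add: algebra_simps)

lemma contract_bracket:
  assumes X: "X \<in> WW" and Y: "Y \<in> Wp e" and a: "a \<in> PA f"
  shows "contract a (WB X Y) = WB X (contract a Y) + ksign (f * e) (WB (contract a X) Y)"
  using X
proof (induction X rule: WS.homogeneous_induct)
  case (add X1 X2)
  then show ?case
    by (simp add: bracket_add_left W_contract Wp_subset[OF Y] contract_add ksign_plus
        del: plus_fun_apply contract_apply)
qed (rule contract_bracket_homogeneous[OF _ Y a])

lemma bracket_homogeneous_Nil:
  assumes X: "X \<in> Wp d" and Y: "Y \<in> Wp e"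
  shows "WB X Y [] = X [Y []] - ksign (d * e) (Y [X []])"
  by (simp add: bracket_homogeneous[OF assms] box_Nil ksign_apply)

lemma bracket_skew:
  assumes X: "X \<in> Wp d" and Y: "Y \<in> Wp e"
  shows "WB X Y = - ksign (d * e) (WB Y X)"
  unfolding bracket_homogeneous[OF X Y] bracket_homogeneous[OF Y X]
  by (cases d; cases e) simp_all


section \<open>The concatenation product\<close>

text \<open>\<open>cp X Y\<close> stands for \<open>X \<and> Y\<close>. The parity of an element of \<open>\<Pi>W(\<Pi>A)\<close> is \<open>e\<close> if it lies in
  \<open>Wp (e + 1)\<close>.\<close>

abbreviation "cp \<equiv> concat_prod scale par"

lemma concat_homogeneous:
  assumes "Y \<in> Wp (e + 1)"
  shows "cp X Y as = (\<Sum>ds | length ds = length as. \<Sum>(is, js)\<in>shuffle_perms (length as).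
      ksign (koszul ds (is @ js) + e * (\<Sum>i\<leftarrow>is. ds ! i))
        (X (map ((!) (hcomps par ds as)) is) * Y (map ((!) (hcomps par ds as)) js)))"
proof -
  have "hcomp (parity_shift Wp) e' Y = (if e' = e then Y else 0)" for e'
    using WS.hcomp_homogeneous[OF assms, of "e' + 1"]
    by (cases e; cases e') (simp_all add: hcomp_parity_shift)
  then show ?thesis
    unfolding concat_prod_def Let_def
    by (cases e) (simp_all add: sum_UNIV_bit case_prod_unfold)
qed

lemma concat_add_left: "cp (X1 + X2) Y = cp X1 Y + cp X2 Y"
  by (rule ext) (simp add: concat_prod_def ksign_plus sum.distrib case_prod_unfold Let_def distrib_right)

lemma concat_scale_left: "cp (fscale scale c X) Y = fscale scale c (cp X Y)"
  by (rule ext) (simp add: concat_prod_def fscale_def scale_ksign[symmetric] scale_sum_right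
      case_prod_unfold Let_def scale_times_left)

lemma concat_add_right: "Y1 \<in> WW \<Longrightarrow> Y2 \<in> WW \<Longrightarrow> cp X (Y1 + Y2) = cp X Y1 + cp X Y2"
  by (rule ext) (simp add: concat_prod_def ksign_plus sum.distrib case_prod_unfold Let_def distrib_left
      hcomp_parity_shift WS.hcomp_add)

lemma concat_scale_right: "Y \<in> WW \<Longrightarrow> cp X (fscale scale c Y) = fscale scale c (cp X Y)"
  by (rule ext) (simp add: concat_prod_def hcomp_parity_shift WS.hcomp_scale, 
      simp add: concat_prod_def hcomp_parity_shift fscale_def scale_ksign[symmetric] scale_sum_right
      case_prod_unfold Let_def scale_times_right)

lemma concat_ksign_left: "cp (ksign e X) Y = ksign e (cp X Y)"
  using concat_scale_left[of "-1" X Y] by (simp add: ksign_def fscale_minus_one)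

lemma concat_ksign_right: "Y \<in> WW \<Longrightarrow> cp X (ksign e Y) = ksign e (cp X Y)"
  using concat_scale_right[of Y X "-1"] by (simp add: ksign_def fscale_minus_one)

lemma concat_0_left [simp]: "cp 0 Y = 0"
  using concat_add_left[of 0 0 Y] by simp

lemma concat_0_right [simp]: "cp X 0 = 0"
  using concat_add_right[of 0 0 X] fun_space.subspace_0[OF W_subspace] by simp

lemma concat_Nil: assumes "Y \<in> WW" shows "cp X Y [] = X [] * Y []"
  using assms
proof (induction Y rule: WS.homogeneous_induct)
  case (add Y1 Y2)
  show ?case unfolding concat_add_right[OF add(1,2)] by (simp add: add distrib_left)
next
  case (homogeneous e Y)
  then have "Y \<in> Wp ((e + 1) + 1)" by simp
  from concat_homogeneous[OF this, of X "[]"] show ?case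
    by (simp add: shuffle_perms_0 koszul_Nil)
qed

text \<open>If \<open>a\<close> goes to \<open>Y\<close>, then the Koszul sign for moving \<open>a\<close> past the arguments of \<open>X\<close> is accounted
  for by the parity of the contraction of \<open>Y\<close>, which differs from that of \<open>Y\<close> by the parity of \<open>a\<close>.\<close>

lemma concat_Cons:
  assumes Y: "Y \<in> Wp (e + 1)"
  shows "cp X Y (a # as) =
    (\<Sum>d\<in>UNIV. ksign (e * d) (cp (contract (pc d a) X) Y as) + cp X (contract (pc d a) Y) as)"
proof -
  define T where "T e X Y ds as is js = ksign (koszul ds (is @ js) + e * (\<Sum>i\<leftarrow>is. ds ! i))
      (X (map ((!) (hcomps par ds as)) is) * Y (map ((!) (hcomps par ds as)) js))"
    for e :: bit and X Y :: "'a list \<Rightarrow> 'a" and ds as "is" js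
  have cp: "cp X Y as = (\<Sum>ds | length ds = length as. \<Sum>(is, js)\<in>shuffle_perms (length as). T e X Y ds as is js)"
    if "Y \<in> Wp (e + 1)" for X Y as e
    using concat_homogeneous[OF that] by (simp add: T_def)
  have T1: "T e X Y (d # ds) (a # as) (0 # map Suc is) (map Suc js) =
      ksign (e * d) (T e (contract (pc d a) X) Y ds as is js)" for d ds "is" js
  proof -
    have 1: "koszul (d # ds) ((0 # map Suc is) @ map Suc js) = koszul ds (is @ js)"
      using koszul_0_Cons[of d ds "is @ js"] by simp
    have 2: "(\<Sum>i\<leftarrow>0 # map Suc is. (d # ds) ! i) = d + (\<Sum>i\<leftarrow>is. ds ! i)"
      by (simp add: comp_def)
    have 3: "k + e * (d + s) = e * d + (k + e * s)" for k s :: bit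
      by (simp add: algebra_simps)
    show ?thesis unfolding T_def hcomps_Cons list.map(2) map_nth_map_Suc contract_apply ksign_ksign
        1 2[unfolded list.map(2)] sum_list.Cons 3 nth_Cons_0 ..
  qed
  have T2: "T e X Y (d # ds) (a # as) (map Suc is) (0 # map Suc js) =
      T (e + d) X (contract (pc d a) Y) ds as is js" for d ds "is" js
  proof -
    have 2: "(\<Sum>i\<leftarrow>map Suc is. (d # ds) ! i) = (\<Sum>i\<leftarrow>is. ds ! i)"
      by (simp add: comp_def)
    have 3: "k + d * s + e * s = k + (e + d) * s" for k s :: bit
      by (simp add: algebra_simps)
    show ?thesis unfolding T_def hcomps_Cons list.map(2) map_nth_map_Suc contract_apply
        koszul_insert_0 2[unfolded list.map(2)] 3 nth_Cons_0 ..
  qed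
  have Y': "contract (pc d a) Y \<in> Wp (e + d + 1)" for d
    using Wp_contract[OF Y pc_in_PA, of d a] by (simp add: add_ac)
  show ?thesis
    unfolding cp[OF Y] cp[OF Y'] list.size(4) add_0_right add_Suc_right sum_length_Suc
      sum_shuffle_perms_Suc T1 T2 sum.distrib ksign_sum
    by (simp add: case_prod_unfold)
qed

lemma contract_concat:
  assumes X: "X \<in> WW" and Y: "Y \<in> Wp (e + 1)" and a: "a \<in> PA d"
  shows "contract a (cp X Y) = ksign (e * d) (cp (contract a X) Y) + cp X (contract a Y)"
proof
  fix as
  have Y': "multilinear Y" using Y by (simp add: Wp_subset W_multilinear)
  have X': "multilinear X" using X by (simp add: W_multilinear)
  show "contract a (cp X Y) as = (ksign (e * d) (cp (contract a X) Y) + cp X (contract a Y)) as"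
    using concat_Cons[OF Y, of X a as] Pi.hcomp_homogeneous[OF a]
    by (cases d) (simp_all add: sum_UNIV_bit contract_zero X' Y' ksign_apply)
qed

lemma concat_eq_0:
  assumes "Y \<in> Wp e" and "\<And>i j. i + j = length as \<Longrightarrow>
      (\<forall>bs. length bs = i \<longrightarrow> X bs = 0) \<or> (\<forall>bs. length bs = j \<longrightarrow> Y bs = 0)"
  shows "cp X Y as = 0"
proof -
  have Y: "Y \<in> Wp ((e + 1) + 1)" using assms(1) by simp
  have "X (map b is) * Y (map b js) = 0" if "(is, js) \<in> shuffle_perms (length as)" for b "is" js
    using assms(2)[OF length_shuffle[OF that]] by auto
  then show ?thesis unfolding concat_homogeneous[OF Y] by (intro sum.neutral ballI) auto
qed

lemma concat_multilinear:
  assumes "X \<in> WW" "Y \<in> Wp (e + 1)" shows "multilinear (cp X Y)"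
proof -
  have "linmap (\<lambda>x. cp X Y (bs @ x # as))" for bs as
    using assms
  proof (induction bs arbitrary: X Y e)
    case Nil
    have X: "multilinear X" and Y: "multilinear Y" and YW: "\<And>a. contract a Y \<in> WW"
      using Nil by (simp_all add: Wp_subset W_multilinear W_contract)
    have "linmap (\<lambda>x. cp X (contract x Y) as)"
      by (simp add: linmap_iff contract_add_arg contract_scale_arg Y YW concat_add_right concat_scale_right)
        (simp add: fscale_def)
    moreover have "linmap (\<lambda>x. cp (contract x X) Y as)"
      by (simp add: linmap_iff contract_add_arg contract_scale_arg X concat_add_left concat_scale_left)
        (simp add: fscale_def)
    ultimately show ?case
      unfolding append_Nil concat_Cons[OF Nil(2)]
      by (intro linmap_sum linmap_add linmap_ksign) (auto intro: linmap_comp linmap_pc)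
  next
    case (Cons b bs)
    have "contract (pc d b) Y \<in> Wp (e + d + 1)" for d
      using Wp_contract[OF Cons.prems(2) pc_in_PA, of d b] by (simp add: add_ac)
    then have "linmap (\<lambda>x. cp X (contract (pc d b) Y) (bs @ x # as))" for d
      using Cons.IH[OF Cons.prems(1)] by blast
    moreover have "linmap (\<lambda>x. cp (contract (pc d b) X) Y (bs @ x # as))" for d
      using Cons.IH[OF W_contract[OF Cons.prems(1)] Cons.prems(2)] .
    ultimately show ?case
      unfolding append_Cons concat_Cons[OF Cons.prems(2)]
      by (intro linmap_sum linmap_add linmap_ksign)
  qed
  then show ?thesis by (simp add: multilinear_def)
qed

lemma concat_supersymmetric:
  assumes "X \<in> WW" "Y \<in> Wp (e + 1)" shows "supersymmetric (cp X Y)"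
proof (rule supersymmetricI)
  fix bs as x y d f assume xy: "x \<in> PA d" "y \<in> PA f"
  have shift: "contract a Y \<in> Wp (e + d + 1)" if "Y \<in> Wp (e + 1)" "a \<in> PA d" for a Y d e
    using Wp_contract[OF that] by (simp add: add_ac)
  show "cp X Y (bs @ y # x # as) = ksign (d * f) (cp X Y (bs @ x # y # as))"
    using assms
  proof (induction bs arbitrary: X Y e)
    case (Nil X Y)
    have X: "supersymmetric X" and Y: "supersymmetric Y"
      and YW: "\<And>a b. contract a (contract b Y) \<in> WW"
      using Nil by (simp_all add: Wp_subset W_supersymmetric W_contract)
    have twice: "contract v (contract u (cp X Y)) =
        ksign (e * h) (ksign (e * g) (cp (contract v (contract u X)) Y) + cp (contract u X) (contract v Y))
        + (ksign ((e + h) * g) (cp (contract v X) (contract u Y)) + cp X (contract v (contract u Y)))"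
      if u: "u \<in> PA h" and v: "v \<in> PA g" for u v g h
      unfolding contract_concat[OF Nil u] contract_add contract_ksign
        contract_concat[OF Nil(1) shift[OF Nil(2) u] v]
        contract_concat[OF W_contract[OF Nil(1)] Nil(2) v] ..
    have "contract x (contract y (cp X Y)) as = ksign (d * f) (contract y (contract x (cp X Y)) as)"
      unfolding twice[OF xy] twice[OF xy(2,1)] contract_swap[OF X xy] contract_swap[OF Y xy]
        concat_ksign_right[OF YW] concat_ksign_left plus_fun_apply ksign_apply
      by (cases d; cases e; cases f) (simp_all add: algebra_simps)
    then show ?case by simp
  next
    case (Cons b bs)
    show ?case
      unfolding append_Cons concat_Cons[OF Cons.prems(2)] ksign_sum ksign_plus
        Cons.IH[OF Cons.prems(1) shift[OF Cons.prems(2) pc_in_PA]]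
        Cons.IH[OF W_contract[OF Cons.prems(1)] Cons.prems(2)]
      by (simp add: add_ac)
  qed
qed

lemma mult_PA: "x \<in> PA d \<Longrightarrow> y \<in> PA e \<Longrightarrow> x * y \<in> PA (d + e + 1)"
  using mult_parity[of x "d + 1" y "e + 1"] by (simp add: parity_shift_def add_ac)

lemma concat_in_PA:
  assumes "X \<in> Wp (d + 1)" "Y \<in> Wp (e + 1)" "list_all2 (\<lambda>a d. a \<in> PA d) as ds"
  shows "cp X Y as \<in> PA (d + e + 1 + sum_list ds)"
  using assms(3,1,2)
proof (induction as ds arbitrary: X Y d e rule: list_all2_induct)
  case Nil
  then have "X [] \<in> PA (d + 1)" "Y [] \<in> PA (e + 1)" by (simp_all add: Wp_apply_Nil)
  from mult_PA[OF this] Nil show ?case by (simp add: concat_Nil Wp_subset add_ac)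
next
  case (Cons a as f ds)
  have shift: "contract a Y \<in> Wp (e + f + 1)" if "Y \<in> Wp (e + 1)" for Y e
    using Wp_contract[OF that Cons.hyps(1)] by (simp add: add_ac)
  have "cp X Y (a # as) = ksign (e * f) (cp (contract a X) Y as) + cp X (contract a Y) as"
    using fun_cong[OF contract_concat[OF Wp_subset[OF Cons.prems(1)] Cons.prems(2) Cons.hyps(1)], of as]
    by (simp add: ksign_apply)
  moreover have "cp X (contract a Y) as \<in> PA (d + (e + f) + 1 + sum_list ds)"
    using Cons.IH[OF Cons.prems(1) shift[OF Cons.prems(2)]] .
  moreover have "cp (contract a X) Y as \<in> PA ((d + f) + e + 1 + sum_list ds)"
    using Cons.IH[OF shift[OF Cons.prems(1)] Cons.prems(2)] .
  ultimately show ?case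
    by (simp add: Pi.ksign_in_par subspace_add[OF Pi.par_subspace] add_ac)
qed

lemma concat_in_Wp:
  assumes "X \<in> Wp (d + 1)" "Y \<in> Wp (e + 1)" shows "cp X Y \<in> Wp (d + e + 1)"
proof -
  have X: "X \<in> WW" and Y: "Y \<in> WW" using assms by (simp_all add: Wp_subset)
  obtain M N where MN: "\<And>as. M \<le> length as \<Longrightarrow> X as = 0" "\<And>as. N \<le> length as \<Longrightarrow> Y as = 0"
    using X Y unfolding W_iff by blast
  have "\<forall>as. M + N \<le> length as \<longrightarrow> cp X Y as = 0"
  proof (intro allI impI concat_eq_0[OF assms(2)])
    fix as :: "'a list" and i j assume "M + N \<le> length as" "i + j = length as"
    then have "M \<le> i \<or> N \<le> j" by linarith
    then show "(\<forall>bs. length bs = i \<longrightarrow> X bs = 0) \<or> (\<forall>bs. length bs = j \<longrightarrow> Y bs = 0)"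
      using MN by auto
  qed
  then have "cp X Y \<in> WW"
    using concat_multilinear[OF X assms(2)] concat_supersymmetric[OF X assms(2)] by (auto simp: W_iff)
  then show ?thesis using concat_in_PA[OF assms] by (simp add: W_par_def)
qed

text \<open>Induction over homogeneous elements, whose parities are those of \<open>\<Pi>W(\<Pi>A)\<close>.\<close>

lemma W_induct_shift [consumes 1, case_names add homogeneous]:
  assumes "X \<in> WW"
    and "\<And>Y Z. Y \<in> WW \<Longrightarrow> Z \<in> WW \<Longrightarrow> P Y \<Longrightarrow> P Z \<Longrightarrow> P (Y + Z)"
    and "\<And>e Y. Y \<in> Wp (e + 1) \<Longrightarrow> P Y"
  shows "P X"
  using assms(1)
proof (induction X rule: WS.homogeneous_induct)
  case (homogeneous e Y)
  then show ?case using assms(3)[of Y "e + 1"] by simp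
qed (rule assms(2))

lemma concat_in_W:
  assumes "X \<in> WW" "Y \<in> WW" shows "cp X Y \<in> WW"
  using assms
proof (induction X rule: W_induct_shift)
  case (add X1 X2)
  then show ?case
    by (simp add: concat_add_left fun_space.subspace_add[OF W_subspace] del: plus_fun_apply)
next
  case (homogeneous d X)
  from homogeneous(2) show ?case
  proof (induction Y rule: W_induct_shift)
    case (add Y1 Y2)
    then show ?case
      by (simp add: concat_add_right fun_space.subspace_add[OF W_subspace] del: plus_fun_apply)
  next
    case (homogeneous e Y)
    with \<open>X \<in> Wp (d + 1)\<close> show ?case using concat_in_Wp Wp_subset by blast
  qed
qed


section \<open>Associativity, supercommutativity and the Jacobi identity\<close>

lemma contract_shifted_parity:
  "Y \<in> Wp (e + 1) \<Longrightarrow> a \<in> PA d \<Longrightarrow> contract a Y \<in> Wp (e + d + 1)"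
  using Wp_contract[of Y "e + 1" a d] by (simp add: add_ac)

lemma concat_assoc_homogeneous:
  assumes X: "X \<in> WW" and Y: "Y \<in> Wp (e + 1)" and Z: "Z \<in> Wp (f + 1)"
  shows "cp (cp X Y) Z = cp X (cp Y Z)"
proof (rule multilinear_eqI)
  have XY: "Y \<in> WW" "Z \<in> WW" using Y Z Wp_subset by blast+
  then show "multilinear (cp (cp X Y) Z)" "multilinear (cp X (cp Y Z))"
    using X by (simp_all add: concat_in_W W_multilinear)
  fix as ds assume "list_all2 (\<lambda>a d. a \<in> PA d) as ds"
  then show "cp (cp X Y) Z as = cp X (cp Y Z) as"
    using X Y Z
  proof (induction as ds arbitrary: X Y Z e f rule: list_all2_induct)
    case Nil
    then show ?case by (simp add: concat_Nil concat_in_W Wp_subset mult.assoc)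
  next
    case (Cons a as d ds)
    note a = \<open>a \<in> PA d\<close>
    note X = Cons.prems(1) and Y = Cons.prems(2) and Z = Cons.prems(3)
    note W = Wp_subset[OF Y] Wp_subset[OF Z]
    note IH = Cons.IH[OF W_contract[OF X] Y Z] Cons.IH[OF X contract_shifted_parity[OF Y a] Z]
      Cons.IH[OF X Y contract_shifted_parity[OF Z a]]
    have "contract a (cp (cp X Y) Z) as = contract a (cp X (cp Y Z)) as"
      unfolding contract_concat[OF concat_in_W[OF X W(1)] Z a] contract_concat[OF X Y a]
        contract_concat[OF X concat_in_Wp[OF Y Z] a] contract_concat[OF W(1) Z a]
        concat_add_left concat_ksign_left
        concat_add_right[OF fun_space.subspace_ksign[OF W_subspace concat_in_W[OF W_contract[OF W(1)] W(2)]]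
          concat_in_W[OF W(1) W_contract[OF W(2)]]]
        concat_ksign_right[OF concat_in_W[OF W_contract[OF W(1)] W(2)]]
        plus_fun_apply ksign_apply ksign_plus IH
      by (cases d; cases e; cases f) (simp_all add: algebra_simps)
    then show ?case by simp
  qed
qed

lemma concat_comm:
  assumes X: "X \<in> Wp (d + 1)" and Y: "Y \<in> Wp (e + 1)"
  shows "cp X Y = ksign (d * e) (cp Y X)"
proof (rule multilinear_eqI)
  have XY: "X \<in> WW" "Y \<in> WW" using X Y Wp_subset by blast+
  then show "multilinear (cp X Y)" "multilinear (ksign (d * e) (cp Y X))"
    by (simp_all add: concat_in_W W_multilinear fun_space.subspace_ksign[OF W_subspace])
  fix as ds assume "list_all2 (\<lambda>a d. a \<in> PA d) as ds"
  then have "cp X Y as = ksign (d * e) (cp Y X as)"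
    using X Y
  proof (induction as ds arbitrary: X Y d e rule: list_all2_induct)
    case Nil
    then have "X [] \<in> par d" "Y [] \<in> par e"
      using Wp_apply_Nil[of X "d + 1"] Wp_apply_Nil[of Y "e + 1"] by (simp_all add: parity_shift_def)
    from supercomm[OF this] Nil show ?case by (simp add: concat_Nil Wp_subset)
  next
    case (Cons a as f ds)
    note a = \<open>a \<in> PA f\<close>
    note X = Cons.prems(1) and Y = Cons.prems(2)
    note IH = Cons.IH[OF contract_shifted_parity[OF X a] Y] Cons.IH[OF X contract_shifted_parity[OF Y a]]
    have "contract a (cp X Y) as = ksign (d * e) (contract a (cp Y X) as)"
      unfolding contract_concat[OF Wp_subset[OF X] Y a] contract_concat[OF Wp_subset[OF Y] X a]
        plus_fun_apply ksign_apply IH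
      by (cases d; cases e; cases f) (simp_all add: algebra_simps)
    then show ?case by simp
  qed
  then show "cp X Y as = ksign (d * e) (cp Y X) as" by (simp add: ksign_apply)
qed

lemma concat_assoc:
  assumes "X \<in> WW" "Y \<in> WW" "Z \<in> WW"
  shows "cp (cp X Y) Z = cp X (cp Y Z)"
  using assms(2,3,1)
proof (induction Y rule: W_induct_shift)
  case (add Y1 Y2)
  then show ?case
    by (simp add: concat_add_left concat_add_right concat_in_W del: plus_fun_apply)
next
  case (homogeneous e Y)
  from homogeneous(2,1,3) show ?case
  proof (induction Z rule: W_induct_shift)
    case (add Z1 Z2)
    then show ?case
      by (simp add: concat_add_right concat_in_W Wp_subset del: plus_fun_apply)
  qed (rule concat_assoc_homogeneous)
qed

lemma one_even: "1 \<in> par 0"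
proof -
  let ?u = "hcomp par 0 1" and ?v = "hcomp par 1 1"
  have uv: "?u \<in> par 0" "?v \<in> par 1" "?u + ?v = 1"
    using hcomp_in_par[of 1] hcomp_sum[of 1] by simp_all
  \<comment> \<open>Comparison of the components of \<open>1 * u = u\<close> and of \<open>v * 1 = v\<close>.\<close>
  have vu: "?v * ?u = 0"
  proof -
    have "hcomp par 1 (?u * ?u + ?v * ?u) = hcomp par 1 ?u"
      by (metis distrib_right mult_1_left uv(3))
    moreover have "?u * ?u \<in> par 0" "?v * ?u \<in> par 1"
      using mult_parity[OF uv(1) uv(1)] mult_parity[OF uv(2) uv(1)] by simp_all
    ultimately show ?thesis
      using uv by (simp add: hcomp_add hcomp_homogeneous)
  qed
  have "hcomp par 1 (?v * ?u + ?v * ?v) = hcomp par 1 ?v"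
    by (metis distrib_left mult_1_right uv(3))
  moreover have "?v * ?v \<in> par 0" using mult_parity[OF uv(2) uv(2)] by simp
  ultimately have "?v = 0"
    using uv vu by (simp add: hcomp_homogeneous)
  with uv show ?thesis by simp
qed

lemma W_const_apply [simp]: "W_const a [] = a" "W_const a (b # bs) = 0"
  by (simp_all add: W_const_def)

lemma contract_W_const [simp]: "contract b (W_const a) = 0"
  by (rule ext) simp

lemma W_const_W_hom: "W_const a \<in> W_hom scale par (-1)"
  unfolding W_hom_iff by (auto simp: W_const_def multilinear_def linmap_0 intro: supersymmetricI)

lemma W_const_W: "W_const a \<in> WW"
  using W_const_W_hom W_hom_subset by blast

lemma W_hom_minus_1: "X \<in> W_hom scale par (-1) \<Longrightarrow> X = W_const (X [])"
  by (auto simp: W_hom_iff W_const_def)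

lemma W_const_add: "W_const (a + b) = W_const a + W_const b"
  by (rule ext) (simp add: W_const_def)

lemma W_const_Wp: assumes "a \<in> PA d" shows "W_const a \<in> Wp d"
  unfolding W_par_def
proof (intro CollectI conjI allI impI W_const_W)
  fix as ds assume "list_all2 (\<lambda>a d. a \<in> PA d) as ds"
  then show "W_const a as \<in> PA (d + sum_list ds)"
    using assms by (cases as) auto
qed

text \<open>The unit of the concatenation product: \<open>1 \<in> A\<close> as an element of \<open>W\<^sub>-\<^sub>1(\<Pi>A)\<close>.\<close>

abbreviation "W1 \<equiv> W_const (1::'a) :: 'a list \<Rightarrow> 'a"

lemma W1_Wp: "W1 \<in> Wp (0 + 1)"
  using one_even by (intro W_const_Wp) (simp add: parity_shift_def)

lemma concat_unit_left:
  assumes "X \<in> WW" shows "cp W1 X = X"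
proof (rule multilinear_eqI)
  show "multilinear (cp W1 X)" "multilinear X"
    using assms by (simp_all add: concat_in_W W_const_W W_multilinear)
  have *: "cp W1 X as = X as" if "list_all2 (\<lambda>a d. a \<in> PA d) as ds" "X \<in> Wp (e + 1)" for X as ds e
    using that
  proof (induction as ds arbitrary: X e rule: list_all2_induct)
    case Nil
    then show ?case by (simp add: concat_Nil Wp_subset)
  next
    case (Cons a as d ds)
    note a = \<open>a \<in> PA d\<close>
    have "contract a (cp W1 X) as = contract a X as"
      unfolding contract_concat[OF W_const_W Cons.prems a] contract_W_const concat_0_left plus_fun_apply
        Cons.IH[OF contract_shifted_parity[OF Cons.prems a]] by simp
    then show ?case by simp
  qed
  fix as ds assume "list_all2 (\<lambda>a d. a \<in> PA d) as ds"
  from assms show "cp W1 X as = X as"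
  proof (induction X rule: W_induct_shift)
    case (add Y Z)
    show ?case unfolding concat_add_right[OF add(1,2)] by (simp add: add)
  qed (rule *[OF \<open>list_all2 (\<lambda>a d. a \<in> PA d) as ds\<close>])
qed

lemma concat_unit_right:
  assumes "X \<in> WW" shows "cp X W1 = X"
  using assms
proof (induction X rule: W_induct_shift)
  case (add Y Z)
  then show ?case by (simp add: concat_add_left del: plus_fun_apply)
next
  case (homogeneous e X)
  then show ?case
    using concat_comm[OF homogeneous W1_Wp] by (simp add: concat_unit_left Wp_subset)
qed

text \<open>The value of a bracket at a single argument, needed for the Jacobi identity at the empty list:
  \<open>Y \<box> [X, Z]\<close>, for instance, evaluates the inner bracket at no argument, but \<open>[X, Z] \<box> Y\<close> evaluates
  it at \<open>Y()\<close>.\<close>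

lemma bracket_singleton:
  assumes X: "X \<in> Wp d" and Y: "Y \<in> Wp e" and a: "a \<in> PA f"
  shows "WB X Y [a] = X [Y [a]] - ksign (d * (e + f)) (Y [a, X []])
    + ksign (f * e) (X [a, Y []] - ksign ((d + f) * e) (Y [X [a]]))"
  using fun_cong[OF contract_bracket[OF Wp_subset[OF X] Y a], of "[]"]
    bracket_homogeneous_Nil[OF X Wp_contract[OF Y a]]
    bracket_homogeneous_Nil[OF Wp_contract[OF X a] Y]
  by (simp add: ksign_apply)

lemma multilinear_diff_ksign:
  "multilinear X \<Longrightarrow> X ((u - ksign e v) # as) = X (u # as) - ksign e (X (v # as))"
  using multilinear_add_Cons[of X u "ksign (e + 1) v" as] multilinear_ksign_Cons[of X "e + 1" v as]
  by (cases e) simp_all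

lemma jacobi_homogeneous:
  assumes X: "X \<in> Wp x" and Y: "Y \<in> Wp y" and Z: "Z \<in> Wp z"
  shows "WB X (WB Y Z) = WB (WB X Y) Z + ksign (x * y) (WB Y (WB X Z))"
proof (rule multilinear_eqI)
  have "X \<in> WW" "Y \<in> WW" "Z \<in> WW" using X Y Z Wp_subset by blast+
  then show "multilinear (WB X (WB Y Z))" "multilinear (WB (WB X Y) Z + ksign (x * y) (WB Y (WB X Z)))"
    by (simp_all add: bracket_in_W W_multilinear fun_space.subspace_ksign[OF W_subspace]
        multilinear_add del: plus_fun_apply)
  fix as ds assume "list_all2 (\<lambda>a d. a \<in> PA d) as ds"
  then have "WB X (WB Y Z) as = WB (WB X Y) Z as + ksign (x * y) (WB Y (WB X Z) as)"
    using X Y Z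
  proof (induction as ds arbitrary: X Y Z x y z rule: list_all2_induct)
    case (Nil X Y Z)
    \<comment> \<open>Terms of the form \<open>X(Y(Z()))\<close> cancel directly, those of the form \<open>X(Y(), Z())\<close> after a swap.\<close>
    note X = Nil(1) and Y = Nil(2) and Z = Nil(3)
    note ml = W_multilinear[OF Wp_subset[OF X]] W_multilinear[OF Wp_subset[OF Y]] W_multilinear[OF Wp_subset[OF Z]]
    note ss = W_supersymmetric[OF Wp_subset[OF X]] W_supersymmetric[OF Wp_subset[OF Y]] W_supersymmetric[OF Wp_subset[OF Z]]
    note p = Wp_apply_Nil[OF X] Wp_apply_Nil[OF Y] Wp_apply_Nil[OF Z]
    show ?case
      unfolding bracket_homogeneous_Nil[OF X bracket_in_Wp[OF Y Z]]
        bracket_homogeneous_Nil[OF bracket_in_Wp[OF X Y] Z]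
        bracket_homogeneous_Nil[OF Y bracket_in_Wp[OF X Z]]
        bracket_singleton[OF X Y p(3)] bracket_singleton[OF Y Z p(1)] bracket_singleton[OF X Z p(2)]
        bracket_homogeneous_Nil[OF X Y] bracket_homogeneous_Nil[OF X Z] bracket_homogeneous_Nil[OF Y Z]
        multilinear_diff_ksign[OF ml(1)] multilinear_diff_ksign[OF ml(2)] multilinear_diff_ksign[OF ml(3)]
        supersymmetric_swap[OF ss(1) p(2,3)] supersymmetric_swap[OF ss(2) p(1,3)] supersymmetric_swap[OF ss(3) p(1,2)]
      by (cases x; cases y; cases z) (simp_all add: algebra_simps)
  next
    case (Cons a as f ds)
    note a = \<open>a \<in> PA f\<close>
    note X = Cons.prems(1) and Y = Cons.prems(2) and Z = Cons.prems(3)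
    note W = Wp_subset[OF X] Wp_subset[OF Y] Wp_subset[OF Z]
    note C = Wp_contract[OF X a] Wp_contract[OF Y a] Wp_contract[OF Z a]
    note CW = W_contract[OF W(1)] W_contract[OF W(2)] W_contract[OF W(3)]
    note IH = Cons.IH[OF C(1) Y Z] Cons.IH[OF X C(2) Z] Cons.IH[OF X Y C(3)]
    note kW = fun_space.subspace_ksign[OF W_subspace]
    have expand_right: "contract a (WB P (WB Q R)) =
        WB P (WB Q (contract a R)) + ksign (f * r) (WB P (WB (contract a Q) R))
        + ksign (f * (q + r)) (WB (contract a P) (WB Q R))"
      if P: "P \<in> WW" and Q: "Q \<in> Wp q" and R: "R \<in> Wp r" for P Q R q r
      using P Wp_subset[OF Q] Wp_subset[OF R] bracket_in_W W_contract kW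
      unfolding contract_bracket[OF P bracket_in_Wp[OF Q R] a] contract_bracket[OF Wp_subset[OF Q] R a]
      by (simp add: bracket_add_right bracket_ksign_right bracket_in_W del: plus_fun_apply contract_apply)
    have expand_left: "contract a (WB (WB X Y) Z) =
        WB (WB X Y) (contract a Z) + ksign (f * z) (WB (WB X (contract a Y)) Z + ksign (f * y) (WB (WB (contract a X) Y) Z))"
      using W CW kW bracket_in_W
      unfolding contract_bracket[OF bracket_in_W[OF W(1,2)] Z a] contract_bracket[OF W(1) Y a]
      by (simp add: bracket_add_left bracket_ksign_left del: plus_fun_apply contract_apply)
    have "contract a (WB X (WB Y Z)) as =
        contract a (WB (WB X Y) Z) as + ksign (x * y) (contract a (WB Y (WB X Z)) as)"
      unfolding expand_right[OF W(1) Y Z] expand_right[OF W(2) X Z] expand_left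
        plus_fun_apply ksign_apply IH
      by (cases x; cases y; cases z; cases f) (simp_all add: algebra_simps)
    then show ?case by simp
  qed
  then show "WB X (WB Y Z) as = (WB (WB X Y) Z + ksign (x * y) (WB Y (WB X Z))) as"
    by (simp add: ksign_apply)
qed

lemma jacobi:
  assumes X: "X \<in> Wp x" and Y: "Y \<in> Wp y" and Z: "Z \<in> WW"
  shows "WB X (WB Y Z) = WB (WB X Y) Z + ksign (x * y) (WB Y (WB X Z))"
  using Z
proof (induction Z rule: WS.homogeneous_induct)
  case (add Z1 Z2)
  then show ?case
    using Wp_subset[OF X] Wp_subset[OF Y]
    by (simp add: bracket_add_right bracket_in_W ksign_plus add_ac del: plus_fun_apply)
qed (rule jacobi_homogeneous[OF X Y])


section \<open>Generalized derivations\<close>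

abbreviation "GD \<equiv> GDer scale par"

lemma GDerI:
  "linmap D \<Longrightarrow> (\<And>d e b c. b \<in> par d \<Longrightarrow> c \<in> par e \<Longrightarrow>
      D (b * c) = D b * c + ksign (d * e) (D c * b) - D 1 * b * c) \<Longrightarrow> D \<in> GD"
  by (simp add: GDer_def)

lemma GDerD:
  "D \<in> GD \<Longrightarrow> b \<in> par d \<Longrightarrow> c \<in> par e \<Longrightarrow>
      D (b * c) = D b * c + ksign (d * e) (D c * b) - D 1 * b * c"
  by (simp add: GDer_def)

lemma GDer_linmap: "D \<in> GD \<Longrightarrow> linmap D"
  by (simp add: GDer_def)

lemma GDer_0: "(\<lambda>a. 0) \<in> GD"
  by (intro GDerI linmap_0) simp

lemma GDer_add:
  assumes D: "D \<in> GD" and E: "E \<in> GD" shows "(\<lambda>a. D a + E a) \<in> GD"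
proof (rule GDerI)
  show "linmap (\<lambda>a. D a + E a)" by (rule linmap_add[OF GDer_linmap[OF D] GDer_linmap[OF E]])
  fix d e b c assume bc: "b \<in> par d" "c \<in> par e"
  show "D (b * c) + E (b * c) =
      (D b + E b) * c + ksign (d * e) ((D c + E c) * b) - (D 1 + E 1) * b * c"
    unfolding GDerD[OF D bc] GDerD[OF E bc] by (simp add: ksign_plus algebra_simps)
qed

lemma GDer_scale:
  assumes D: "D \<in> GD" shows "(\<lambda>a. scale k (D a)) \<in> GD"
proof (rule GDerI)
  show "linmap (\<lambda>a. scale k (D a))" by (rule linmap_scale[OF GDer_linmap[OF D]])
  fix d e b c assume bc: "b \<in> par d" "c \<in> par e"
  show "scale k (D (b * c)) =
      scale k (D b) * c + ksign (d * e) (scale k (D c) * b) - scale k (D 1) * b * c"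
    unfolding GDerD[OF D bc]
    by (simp add: scale_ksign scale_right_distrib scale_right_diff_distrib scale_times_left)
qed

lemma GDer_ksign: "D \<in> GD \<Longrightarrow> (\<lambda>a. ksign e (D a)) \<in> GD"
  using GDer_scale[of D "-1"] by (cases e) simp_all

lemma GDer_sum:
  assumes "finite I" "\<And>i. D i \<in> GD" shows "(\<lambda>a. \<Sum>i\<in>I. D i a) \<in> GD"
  using assms(1) by (induction I rule: finite_induct) (simp_all add: GDer_0 GDer_add assms(2))

lemma GDer_mult_left:
  assumes "D \<in> GD" shows "(\<lambda>a. y * D a) \<in> GD"
proof (rule GDerI)
  show "linmap (\<lambda>a. y * D a)"
    using GDer_linmap[OF assms] by (simp add: linmap_iff distrib_left scale_times_right)
  fix d e b c assume "b \<in> par d" "c \<in> par e"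
  then show "y * D (b * c) = y * D b * c + ksign (d * e) (y * D c * b) - y * D 1 * b * c"
    by (simp add: GDerD[OF assms] distrib_left right_diff_distrib ksign_mult_right mult.assoc)
qed

text \<open>Up to sign, \<open>flip\<close> is the parity automorphism of the algebra \<open>A\<close>: \<open>flip a = - (-1)\<^sup>d a\<close> for \<open>a\<close> of
  parity \<open>d\<close> in \<open>A\<close>. Hence conjugation by \<open>flip\<close> preserves generalized derivations.\<close>

lemma flip_mult:
  assumes "c \<in> par e" shows "flip (v * c) = ksign e (flip v * c)"
proof -
  have par: "flip a = ksign (d + 1) a" if "a \<in> par d" for a d
    using flip_homogeneous[of a "d + 1"] that by (simp add: parity_shift_def)
  have "v \<in> UNIV" by simp
  then show ?thesis
  proof (induction v rule: homogeneous_induct)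
    case (add y z)
    then show ?case
      using linmap_flip by (simp add: linmap_iff distrib_right ksign_plus)
  next
    case (homogeneous d y)
    then show ?case
      using par[OF mult_parity[OF homogeneous assms]] par[OF homogeneous]
      by (simp add: ksign_mult_left add_ac)
  qed
qed

lemma GDer_flip:
  assumes "D \<in> GD" shows "(\<lambda>a. flip (D (flip a))) \<in> GD"
proof (rule GDerI)
  have D: "linmap D" by (rule GDer_linmap[OF assms])
  show "linmap (\<lambda>a. flip (D (flip a)))"
    by (intro linmap_comp[OF linmap_flip] linmap_comp[OF D] linmap_flip)
  have par: "flip a = ksign (d + 1) a" if "a \<in> par d" for a d
    using flip_homogeneous[of a "d + 1"] that by (simp add: parity_shift_def)
  note sg = linmap_apply_ksign[OF D] linmap_apply_ksign[OF linmap_flip]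
  have flip_add: "flip (u + v) = flip u + flip v" "flip (u - v) = flip u - flip v" for u v
    using linmap_flip linmap_neg[OF linmap_flip, of v]
    by (auto simp: linmap_iff) (metis add_uminus_conv_diff)
  fix d e b c assume b: "b \<in> par d" and c: "c \<in> par e"
  have "flip (D (flip (b * c))) = ksign (d + e + 1) (flip (D (b * c)))"
    unfolding par[OF mult_parity[OF b c]] sg ..
  then show "flip (D (flip (b * c))) = flip (D (flip b)) * c + ksign (d * e) (flip (D (flip c)) * b)
      - flip (D (flip 1)) * b * c"
    unfolding par[OF b] par[OF c] par[OF one_even] GDerD[OF assms b c] flip_add sg
      flip_mult[OF b] flip_mult[OF c]
    by (cases d; cases e) (simp_all add: algebra_simps)
qed

text \<open>For the supercommutator of homogeneous \<open>D\<close> and \<open>E\<close>, the products of a value of \<open>D\<close> and a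
  value of \<open>E\<close> cancel by supercommutativity.\<close>

lemma GDer_commutator:
  assumes D: "D \<in> GD" and E: "E \<in> GD"
    and Dp: "\<And>a f. a \<in> par f \<Longrightarrow> D a \<in> par (d + f)"
    and Ep: "\<And>a f. a \<in> par f \<Longrightarrow> E a \<in> par (e + f)"
  shows "(\<lambda>a. D (E a) - ksign (d * e) (E (D a))) \<in> GD"
proof (rule GDerI)
  have "linmap (\<lambda>a. D (E a) + ksign (d * e + 1) (E (D a)))"
    by (intro linmap_add linmap_ksign linmap_comp[OF GDer_linmap[OF D] GDer_linmap[OF E]]
        linmap_comp[OF GDer_linmap[OF E] GDer_linmap[OF D]])
  then show "linmap (\<lambda>a. D (E a) - ksign (d * e) (E (D a)))"
    by (simp add: ksign_minus flip: ksign_ksign)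
  fix \<beta> \<gamma> b c assume b: "b \<in> par \<beta>" and c: "c \<in> par \<gamma>"
  have lin: "F (u + v) = F u + F v" "F (u - v) = F u - F v" "F (ksign s u) = ksign s (F u)"
    if "F \<in> GD" for F u v s
    using GDer_linmap[OF that] linmap_neg[OF GDer_linmap[OF that], of v]
      linmap_apply_ksign[OF GDer_linmap[OF that]]
    by (auto simp: linmap_iff) (metis add_uminus_conv_diff)
  note one = one_even
  have expand: "F (G (b * c)) =
      F (G b) * c + ksign ((\<beta> + g) * \<gamma>) (F c * G b) - F 1 * G b * c
      + ksign (\<beta> * \<gamma>) (F (G c) * b + ksign ((\<gamma> + g) * \<beta>) (F b * G c) - F 1 * G c * b)
      - (F (G 1) * (b * c) + ksign (g * (\<beta> + \<gamma>))
            ((F b * c + ksign (\<beta> * \<gamma>) (F c * b) - F 1 * b * c) * G 1)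
          - F 1 * G 1 * (b * c))"
    if F: "F \<in> GD" and G: "G \<in> GD" and Gp: "\<forall>a f. a \<in> par f \<longrightarrow> G a \<in> par (g + f)" for F G g
  proof -
    have "F (G b * c) = F (G b) * c + ksign ((\<beta> + g) * \<gamma>) (F c * G b) - F 1 * G b * c"
      using GDerD[OF F Gp[rule_format, OF b] c] by (simp add: add.commute)
    moreover have "F (G c * b) = F (G c) * b + ksign ((\<gamma> + g) * \<beta>) (F b * G c) - F 1 * G c * b"
      using GDerD[OF F Gp[rule_format, OF c] b] by (simp add: add.commute)
    moreover have "F (G 1 * (b * c)) = F (G 1) * (b * c) + ksign (g * (\<beta> + \<gamma>))
          ((F b * c + ksign (\<beta> * \<gamma>) (F c * b) - F 1 * b * c) * G 1) - F 1 * G 1 * (b * c)"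
      using GDerD[OF F Gp[rule_format, OF one] mult_parity[OF b c]] by (simp add: GDerD[OF F b c])
    ultimately show ?thesis
      unfolding GDerD[OF G b c] mult.assoc[of "G 1"] lin[OF F] by simp
  qed
  have Dp': "\<forall>a f. a \<in> par f \<longrightarrow> D a \<in> par (d + f)"
    and Ep': "\<forall>a f. a \<in> par f \<longrightarrow> E a \<in> par (e + f)" using Dp Ep by blast+
  \<comment> \<open>Values of \<open>D\<close> and \<open>E\<close> are brought into a standard order, with the value at \<open>1\<close> in front.\<close>
  have comm1: "D b * E c = ksign ((d + \<beta>) * (e + \<gamma>)) (E c * D b)"
    by (rule supercomm[OF Dp[OF b] Ep[OF c]])
  have comm2: "D c * E b = ksign ((d + \<gamma>) * (e + \<beta>)) (E b * D c)"
    by (rule supercomm[OF Dp[OF c] Ep[OF b]])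
  have move: "D u * (v * E 1) = ksign ((d + s + t) * e) (E 1 * (D u * v))"
    "E u * (v * D 1) = ksign ((e + s + t) * d) (D 1 * (E u * v))"
    if "u \<in> par s" "v \<in> par t" for u v s t
    using supercomm[OF mult_parity[OF Dp[OF that(1)] that(2)] Ep[OF one]]
      supercomm[OF mult_parity[OF Ep[OF that(1)] that(2)] Dp[OF one]]
    by (simp_all add: mult.assoc)
  have move1: "D 1 * (b * (c * E 1)) = ksign ((d + \<beta> + \<gamma>) * e) (E 1 * (D 1 * (b * c)))"
    "E 1 * (b * (c * D 1)) = ksign ((e + \<beta> + \<gamma>) * d) (D 1 * (E 1 * (b * c)))"
    using move[OF one mult_parity[OF b c]] by (simp_all add: mult.assoc add_ac)
  show "D (E (b * c)) - ksign (d * e) (E (D (b * c))) =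
      (D (E b) - ksign (d * e) (E (D b))) * c
      + ksign (\<beta> * \<gamma>) ((D (E c) - ksign (d * e) (E (D c))) * b)
      - (D (E 1) - ksign (d * e) (E (D 1))) * b * c"
    unfolding expand[OF D E Ep'] expand[OF E D Dp'] comm1 comm2 distrib_right left_diff_distrib
      ksign_mult_left ksign_mult_right mult.assoc move[OF b c] move[OF c b] move1
    by (cases d; cases e; cases \<beta>; cases \<gamma>) (simp_all add: algebra_simps)
qed


section \<open>The full prolongation\<close>

text \<open>The conditions that define \<open>\<G>W\<^sup>a\<^sup>s(\<Pi>A)\<close> degree by degree amount to one condition: when all
  arguments but the last are fixed, the result is a generalized derivation.\<close>

definition last_GDer :: "('a list \<Rightarrow> 'a) \<Rightarrow> bool" where
  "last_GDer X \<longleftrightarrow> (\<forall>bs. (\<lambda>a. X (bs @ [a])) \<in> GD)"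

text \<open>This set is shown to be \<open>\<G>W\<^sup>a\<^sup>s(\<Pi>A)\<close> in \<open>GW_eq\<close> below.\<close>

definition prolongation :: "('a list \<Rightarrow> 'a) set" where
  "prolongation = {X \<in> WW. last_GDer X}"

lemma last_GDerD: "last_GDer X \<Longrightarrow> (\<lambda>a. X (bs @ [a])) \<in> GD"
  by (simp add: last_GDer_def)

lemma last_GDer_contract: "last_GDer X \<Longrightarrow> last_GDer (contract b X)"
  unfolding last_GDer_def contract_apply append_Cons[symmetric] by blast

lemma prolongation_W: "X \<in> prolongation \<Longrightarrow> X \<in> WW"
  by (simp add: prolongation_def)

lemma prolongation_subspace: "fun_space.subspace prolongation"
proof (rule fun_space.subspaceI)
  show "0 \<in> prolongation"
    using fun_space.subspace_0[OF W_subspace] by (simp add: prolongation_def last_GDer_def GDer_0)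
  fix X assume X: "X \<in> prolongation"
  show "fscale scale c X \<in> prolongation" for c
    using X fun_space.subspace_scale[OF W_subspace, of X c] GDer_scale
    by (simp add: prolongation_def last_GDer_def) (simp add: fscale_def)
  fix Y assume Y: "Y \<in> prolongation"
  have "X + Y \<in> WW" using X Y by (intro fun_space.subspace_add[OF W_subspace] prolongation_W)
  moreover have "last_GDer (X + Y)" using X Y by (simp add: prolongation_def last_GDer_def GDer_add)
  ultimately show "X + Y \<in> prolongation" by (simp only: prolongation_def mem_Collect_eq)
qed

lemma prolongation_arity_part: "X \<in> prolongation \<Longrightarrow> arity_part n X \<in> prolongation"
proof -
  assume X: "X \<in> prolongation"
  have "(\<lambda>a. arity_part n X (bs @ [a])) \<in> GD" for bs
    using X by (cases "Suc (length bs) = n") (simp_all add: arity_part_def GDer_0 prolongation_def last_GDerD)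
  with X show ?thesis unfolding prolongation_def last_GDer_def by (simp add: W_arity_part)
qed

lemma prolongation_flip: "X \<in> prolongation \<Longrightarrow> Wflip X \<in> prolongation"
proof -
  assume X: "X \<in> prolongation"
  then have "(\<lambda>a. flip (X (map flip bs @ [flip a]))) \<in> GD" for bs
    using GDer_flip[OF last_GDerD[of X "map flip bs"]] by (simp add: prolongation_def)
  then have "last_GDer (Wflip X)" by (simp add: last_GDer_def Wflip_def)
  with X show ?thesis by (simp add: prolongation_def W_Wflip)
qed

lemma bracket_W_const_homogeneous:
  assumes X: "X \<in> Wp d" and a: "a \<in> PA e"
  shows "WB X (W_const a) = contract a X"
proof -
  note ca = W_const_Wp[OF a]
  have "bx (W_const a) X as = 0" for as
    by (rule box_eq_0[OF W_multilinear[OF W_const_W]]) (auto simp: W_const_def)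
  then have "WB X (W_const a) = bx X (W_const a)"
    unfolding bracket_homogeneous[OF X ca] by (auto simp: ksign_apply)
  also have "\<dots> = contract a X"
  proof (rule multilinear_eqI)
    show "multilinear (bx X (W_const a))" "multilinear (contract a X)"
      using box_multilinear[OF Wp_subset[OF X] ca] multilinear_contract[OF W_multilinear[OF Wp_subset[OF X]]] by auto
    fix as ds assume "list_all2 (\<lambda>a d. a \<in> PA d) as ds"
    then show "bx X (W_const a) as = contract a X as" using X
    proof (induction as ds arbitrary: X d rule: list_all2_induct)
      case Nil
      then show ?case by (simp add: box_Nil)
    next
      case (Cons b as f ds)
      note b = \<open>b \<in> PA f\<close>
      note W = Wp_subset[OF Cons.prems]
      have "contract b (bx X (W_const a)) as = ksign (f * e) (contract a (contract b X) as)"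
        unfolding contract_box[OF W ca b] contract_W_const box_0_right[OF W_multilinear[OF W]]
          plus_fun_apply ksign_apply Cons.IH[OF Wp_contract[OF Cons.prems b]] by simp
      also have "\<dots> = contract b (contract a X) as"
        unfolding contract_swap[OF W_supersymmetric[OF W] a b] ksign_apply by (simp add: mult.commute)
      finally show ?case by simp
    qed
  qed
  finally show ?thesis .
qed

text \<open>The bracket with an element of \<open>W\<^sub>-\<^sub>1(\<Pi>A)\<close> is the contraction. If \<open>X\<close> is itself in \<open>W\<^sub>-\<^sub>1(\<Pi>A)\<close>,
  then both sides vanish.\<close>

lemma bracket_W_const:
  assumes "X \<in> WW" shows "WB X (W_const a) = contract a X"
  using assms
proof (induction X rule: WS.homogeneous_induct)
  case (add Y Z)
  then show ?case
    by (simp add: bracket_add_left W_const_W contract_add del: plus_fun_apply contract_apply)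
next
  case (homogeneous d X)
  note W = Wp_subset[OF homogeneous]
  have "a \<in> UNIV" by simp
  then show ?case
  proof (induction a rule: Pi.homogeneous_induct)
    case (add y z)
    then show ?case
      by (simp add: W_const_add bracket_add_right W W_const_W contract_add_arg W_multilinear
          del: plus_fun_apply contract_apply)
  qed (rule bracket_W_const_homogeneous[OF homogeneous])
qed

lemma GW_arity_iff:
  "X \<in> GW_arity scale par n \<longleftrightarrow> X \<in> W_hom scale par (int n - 1) \<and> last_GDer X"
proof (induction n arbitrary: X rule: induct_nat_012)
  case 0
  have "last_GDer X" if "X \<in> W_hom scale par (-1)"
    using that by (auto simp: W_hom_iff last_GDer_def GDer_0)
  then show ?case by auto
next
  case 1
  have "last_GDer X" if X: "X \<in> W_hom scale par 0" and D: "(\<lambda>a. X [a]) \<in> GD"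
    unfolding last_GDer_def
  proof
    fix bs show "(\<lambda>a. X (bs @ [a])) \<in> GD"
      using X D by (cases bs) (simp_all add: W_hom_iff GDer_0)
  qed
  moreover have "(\<lambda>a. X [a]) \<in> GD" if "last_GDer X"
    using last_GDerD[OF that, of "[]"] by simp
  ultimately show ?case by auto
next
  case (ge2 n)
  show ?case
  proof
    assume "X \<in> GW_arity scale par (Suc (Suc n))"
    then have X: "X \<in> W_hom scale par (int n + 1)"
      and *: "\<And>Y. Y \<in> W_hom scale par (-1) \<Longrightarrow> WB X Y \<in> GW_arity scale par (Suc n)" by auto
    from X have "X \<in> WW" using W_hom_subset by blast
    then have "last_GDer (contract b X)" for b
      using *[OF W_const_W_hom, of b] by (simp add: bracket_W_const ge2 del: contract_apply)
    then have "(\<lambda>a. X (bs @ [a])) \<in> GD" for bs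
      using X by (cases bs) (auto simp: last_GDer_def W_hom_iff GDer_0)
    with X show "X \<in> W_hom scale par (int (Suc (Suc n)) - 1) \<and> last_GDer X"
      by (simp add: last_GDer_def add_ac)
  next
    assume "X \<in> W_hom scale par (int (Suc (Suc n)) - 1) \<and> last_GDer X"
    then have X: "X \<in> W_hom scale par (int n + 1)" and L: "last_GDer X"
      by (simp_all add: add_ac)
    have "WB X Y \<in> GW_arity scale par (Suc n)" if "Y \<in> W_hom scale par (-1)" for Y
    proof -
      have "WB X Y = contract (Y []) X"
        using bracket_W_const[of X "Y []"] W_hom_minus_1[OF that] X W_hom_subset by auto
      moreover have "contract (Y []) X \<in> W_hom scale par (int (Suc n) - 1)"
        using X by (simp add: W_hom_iff multilinear_contract supersymmetric_contract del: contract_apply)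
          (simp add: contract_def)
      ultimately show ?thesis using ge2 L by (simp add: last_GDer_contract del: contract_apply)
    qed
    with X show "X \<in> GW_arity scale par (Suc (Suc n))" by simp
  qed
qed

text \<open>\<open>GH k\<close> is the component of degree \<open>k\<close>, \<open>Gp e\<close> the component of parity \<open>e\<close> of the prolongation as
  a subspace of \<open>W(\<Pi>A)\<close>, and \<open>Gq e\<close>, introduced below, that of its parity shift.\<close>

abbreviation "GH \<equiv> GW_hom scale par"

lemma GW_hom_iff: "X \<in> GH k \<longleftrightarrow> X \<in> W_hom scale par k \<and> last_GDer X"
proof (cases "k < -1")
  case True
  then show ?thesis by (auto simp: GW_hom_def W_hom_def last_GDer_def GDer_0)
next
  case False
  then have k: "int (nat (k + 1)) - 1 = k" and eq: "GH k = GW_arity scale par (nat (k + 1))"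
    by (simp_all add: GW_hom_def)
  show ?thesis unfolding eq GW_arity_iff k ..
qed

lemma GW_hom_eq: "GH k = {X \<in> prolongation. \<forall>as. int (length as) \<noteq> k + 1 \<longrightarrow> X as = 0}"
proof -
  have "W_hom scale par k = {X \<in> WW. \<forall>as. int (length as) \<noteq> k + 1 \<longrightarrow> X as = 0}"
    using W_hom_subset[of k] W_multilinear W_supersymmetric by (auto simp: W_hom_iff)
  then show ?thesis unfolding prolongation_def by (auto simp: GW_hom_iff)
qed

lemma GW_eq: "GW scale par = prolongation"
  unfolding GW_def GW_hom_eq
proof (rule span_arity_parts[OF prolongation_subspace _ prolongation_arity_part])
  show "\<exists>N. \<forall>as. N \<le> length as \<longrightarrow> X as = 0" if "X \<in> prolongation" for X
    using prolongation_W[OF that] by (simp add: W_iff)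
qed

abbreviation "Gp \<equiv> GW_par scale par"

lemma GW_par_eq: "Gp e = prolongation \<inter> Wp e"
  by (simp add: GW_par_def GW_eq)

sublocale GS: superspace "fscale scale" prolongation Gp
proof unfold_locales
  have "fun_space.internal_direct_sum (\<lambda>e. prolongation \<inter> Wp (e + 0)) prolongation"
    by (rule parity_direct_sum) (auto simp: prolongation_subspace prolongation_flip prolongation_W)
  then show "fun_space.internal_direct_sum Gp prolongation" by (simp add: GW_par_eq[abs_def])
qed

lemma concat_in_prolongation:
  assumes "X \<in> prolongation" "Y \<in> prolongation" shows "cp X Y \<in> prolongation"
proof -
  have hom: "(\<lambda>a. cp X Y (bs @ [a])) \<in> GD"
    if "last_GDer X" "X \<in> Wp (d + 1)" "last_GDer Y" "Y \<in> Wp (e + 1)" for X Y d e bs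
    using that
  proof (induction bs arbitrary: X Y d e)
    case (Nil X Y d e)
    note X = Nil(2) and Y = Nil(4)
    have "cp X Y [a] = ksign (d * e) (Y [] * X [a]) + X [] * Y [a]" for a
    proof -
      have "a \<in> UNIV" by simp
      then show ?thesis
      proof (induction a rule: Pi.homogeneous_induct)
        case (add y z)
        have "multilinear (cp X Y)" "multilinear X" "multilinear Y"
          using X Y by (simp_all add: W_multilinear concat_in_W Wp_subset)
        with add show ?case
          by (simp add: multilinear_add_Cons ksign_plus distrib_left)
      next
        case (homogeneous f a)
        have "cp X Y [a] = ksign (e * f) (X [a] * Y []) + X [] * Y [a]"
          using fun_cong[OF contract_concat[OF Wp_subset[OF X] Y homogeneous], of "[]"]
          by (simp add: concat_Nil Wp_subset[OF Y] W_contract ksign_apply del: contract_apply)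
            (simp add: contract_def)
        moreover have "X [a] \<in> par (d + f)" "Y [] \<in> par e"
          using Wp_apply[OF X, of "[a]" "[f]"] Wp_apply_Nil[OF Y] homogeneous
          by (simp_all add: parity_shift_def add_ac)
        then have "X [a] * Y [] = ksign ((d + f) * e) (Y [] * X [a])" by (rule supercomm)
        ultimately show ?case by (cases d; cases e; cases f) simp_all
      qed
    qed
    then show ?case
      using Nil last_GDerD[of X "[]"] last_GDerD[of Y "[]"]
      by (simp add: GDer_add GDer_ksign GDer_mult_left)
  next
    case (Cons b bs)
    note X = Cons.prems(2) and Y = Cons.prems(4)
    have "(\<lambda>a. cp (contract (pc f b) X) Y (bs @ [a])) \<in> GD" for f
      using Cons.IH[OF last_GDer_contract[OF Cons.prems(1)] contract_shifted_parity[OF X pc_in_PA] Cons.prems(3,4)] .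
    moreover have "(\<lambda>a. cp X (contract (pc f b) Y) (bs @ [a])) \<in> GD" for f
      using Cons.IH[OF Cons.prems(1,2) last_GDer_contract[OF Cons.prems(3)] contract_shifted_parity[OF Y pc_in_PA]] .
    ultimately show ?case
      unfolding append_Cons concat_Cons[OF Y]
      by (intro GDer_sum GDer_add GDer_ksign finite_UNIV_bit)
  qed
  have hom': "cp X Y \<in> prolongation" if "X \<in> Gp d" "Y \<in> Gp e" for X Y d e
  proof -
    from that have "last_GDer X" "X \<in> Wp ((d + 1) + 1)" "last_GDer Y" "Y \<in> Wp ((e + 1) + 1)"
      by (simp_all add: GW_par_eq prolongation_def)
    from hom[OF this] have "last_GDer (cp X Y)" by (simp add: last_GDer_def)
    with that show ?thesis by (simp add: GW_par_eq prolongation_def concat_in_W)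
  qed
  show ?thesis
    using assms
  proof (induction X rule: GS.homogeneous_induct)
    case (add X1 X2)
    then show ?case
      by (simp add: concat_add_left fun_space.subspace_add[OF prolongation_subspace] del: plus_fun_apply)
  next
    case (homogeneous d X)
    from homogeneous(2) show ?case
    proof (induction Y rule: GS.homogeneous_induct)
      case (add Y1 Y2)
      then show ?case
        by (simp add: concat_add_right prolongation_W fun_space.subspace_add[OF prolongation_subspace]
            del: plus_fun_apply)
    qed (rule hom'[OF homogeneous(1)])
  qed
qed

lemma bracket_in_prolongation:
  assumes "X \<in> prolongation" "Y \<in> prolongation" shows "WB X Y \<in> prolongation"
proof -
  have hom: "(\<lambda>a. WB X Y (bs @ [a])) \<in> GD"
    if "last_GDer X" "X \<in> Wp d" "last_GDer Y" "Y \<in> Wp e" for X Y d e bs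
    using that
  proof (induction bs arbitrary: X Y d e)
    case (Nil X Y d e)
    note X = Nil(2) and Y = Nil(4)
    have ml: "multilinear (WB X Y)" "multilinear X" "multilinear Y"
      using X Y by (simp_all add: W_multilinear bracket_in_W Wp_subset)
    have "WB X Y [a] = (X [Y [a]] - ksign (d * e) (Y [X [a]])) + ksign (d * e + 1) (Y [X [], a]) + X [Y [], a]" for a
    proof -
      have "a \<in> UNIV" by simp
      then show ?thesis
      proof (induction a rule: Pi.homogeneous_induct)
        case (add y z)
        have "X [v, y + z] = X [v, y] + X [v, z]" "Y [v, y + z] = Y [v, y] + Y [v, z]" for v
          using multilinear_linmap[OF ml(2), of "[v]" "[]"] multilinear_linmap[OF ml(3), of "[v]" "[]"]
          by (simp_all add: linmap_iff)
        with add ml show ?case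
          by (simp add: multilinear_add_Cons ksign_plus algebra_simps)
      next
        case (homogeneous f a)
        note p = Wp_apply_Nil[OF X] Wp_apply_Nil[OF Y]
        show ?case
          unfolding bracket_singleton[OF X Y homogeneous]
            supersymmetric_swap[OF W_supersymmetric[OF Wp_subset[OF Y]] p(1) homogeneous]
            supersymmetric_swap[OF W_supersymmetric[OF Wp_subset[OF X]] p(2) homogeneous]
          by (cases d; cases e; cases f) (simp_all add: algebra_simps)
      qed
    qed
    moreover have "(\<lambda>a. X [Y [a]] - ksign (d * e) (Y [X [a]])) \<in> GD"
    proof (rule GDer_commutator)
      show "(\<lambda>a. X [a]) \<in> GD" "(\<lambda>a. Y [a]) \<in> GD"
        using Nil last_GDerD[of X "[]"] last_GDerD[of Y "[]"] by simp_all
      show "X [a] \<in> par (d + f)" "Y [a] \<in> par (e + f)" if "a \<in> par f" for a f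
        using Wp_apply[OF X, of "[a]" "[f + 1]"] Wp_apply[OF Y, of "[a]" "[f + 1]"] that
        by (simp_all add: parity_shift_def add_ac)
    qed
    moreover have "(\<lambda>a. Y [X [], a]) \<in> GD" "(\<lambda>a. X [Y [], a]) \<in> GD"
      using Nil last_GDerD[of Y "[X []]"] last_GDerD[of X "[Y []]"] by simp_all
    ultimately show ?case by (simp add: GDer_add GDer_ksign)
  next
    case (Cons b bs)
    note X = Cons.prems(2) and Y = Cons.prems(4)
    have "multilinear (WB X Y)"
      using X Y by (simp add: W_multilinear bracket_in_W Wp_subset)
    then have "WB X Y (b # as) = (\<Sum>f\<in>UNIV. contract (pc f b) (WB X Y) as)" for as
      using multilinear_add_Cons[of "WB X Y" "pc 0 b" "pc 1 b" as]
      by (simp add: sum_UNIV_bit pc_sum)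
    then have "WB X Y (b # as) = (\<Sum>f\<in>UNIV. WB X (contract (pc f b) Y) as
        + ksign (f * e) (WB (contract (pc f b) X) Y as))" for as
      unfolding contract_bracket[OF Wp_subset[OF X] Y pc_in_PA] plus_fun_apply ksign_apply .
    moreover have "(\<lambda>a. WB (contract (pc f b) X) Y (bs @ [a])) \<in> GD" for f
      using Cons.IH[OF last_GDer_contract[OF Cons.prems(1)] Wp_contract[OF X pc_in_PA] Cons.prems(3,4)] .
    moreover have "(\<lambda>a. WB X (contract (pc f b) Y) (bs @ [a])) \<in> GD" for f
      using Cons.IH[OF Cons.prems(1,2) last_GDer_contract[OF Cons.prems(3)] Wp_contract[OF Y pc_in_PA]] .
    ultimately show ?case
      by (simp only: append_Cons) (intro GDer_sum GDer_add GDer_ksign finite_UNIV_bit)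
  qed
  have hom': "WB X Y \<in> prolongation" if "X \<in> Gp d" "Y \<in> Gp e" for X Y d e
  proof -
    from that have "last_GDer X" "X \<in> Wp d" "last_GDer Y" "Y \<in> Wp e"
      by (simp_all add: GW_par_eq prolongation_def)
    from hom[OF this] have "last_GDer (WB X Y)" by (simp add: last_GDer_def)
    with that show ?thesis by (simp add: GW_par_eq prolongation_def bracket_in_W)
  qed
  show ?thesis
    using assms
  proof (induction X rule: GS.homogeneous_induct)
    case (add X1 X2)
    then show ?case
      by (simp add: bracket_add_left prolongation_W fun_space.subspace_add[OF prolongation_subspace]
          del: plus_fun_apply)
  next
    case (homogeneous d X)
    then have XW: "X \<in> WW" by (simp add: GW_par_eq prolongation_W)
    from homogeneous(2) show ?case
    proof (induction Y rule: GS.homogeneous_induct)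
      case (add Y1 Y2)
      then show ?case
        by (simp add: bracket_add_right XW prolongation_W fun_space.subspace_add[OF prolongation_subspace]
            del: plus_fun_apply)
    qed (rule hom'[OF homogeneous(1)])
  qed
qed

text \<open>Only \<open>X\<close> has to satisfy the condition on generalized derivations. The correction term contracts
  like the others because the contraction of the unit is \<open>0\<close>.\<close>

lemma leibniz_homogeneous:
  assumes X: "X \<in> Wp (x + 1)" and L: "last_GDer X" and Y: "Y \<in> Wp (y + 1)" and Z: "Z \<in> Wp (z + 1)"
  shows "WB X (cp Y Z) = cp (WB X Y) Z + ksign ((x + 1) * y) (cp Y (WB X Z))
    + ksign (x + 1) (cp (cp (WB W1 X) Y) Z)"
proof (rule multilinear_eqI)
  have W: "X \<in> WW" "Y \<in> WW" "Z \<in> WW" using X Y Z Wp_subset by blast+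
  then show "multilinear (WB X (cp Y Z))" "multilinear (cp (WB X Y) Z + ksign ((x + 1) * y) (cp Y (WB X Z))
      + ksign (x + 1) (cp (cp (WB W1 X) Y) Z))"
    by (simp_all add: bracket_in_W concat_in_W W_const_W W_multilinear
        fun_space.subspace_ksign[OF W_subspace] multilinear_add del: plus_fun_apply)
  fix as ds assume "list_all2 (\<lambda>a d. a \<in> PA d) as ds"
  then have "WB X (cp Y Z) as = cp (WB X Y) Z as + ksign ((x + 1) * y) (cp Y (WB X Z) as)
      + ksign (x + 1) (cp (cp (WB W1 X) Y) Z as)"
    using X L Y Z
  proof (induction as ds arbitrary: X Y Z x y z rule: list_all2_induct)
    case (Nil X Y Z)
    note X = Nil(1) and Y = Nil(3) and Z = Nil(4)
    note W = Wp_subset[OF X] Wp_subset[OF Y] Wp_subset[OF Z]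
    let ?p = "X []" and ?q = "Y []" and ?r = "Z []"
    have p: "?p \<in> PA (x + 1)" by (rule Wp_apply_Nil[OF X])
    have q: "?q \<in> par y" and r: "?r \<in> par z"
      using Wp_apply_Nil[OF Y] Wp_apply_Nil[OF Z] by (simp_all add: parity_shift_def)
    have D: "X [?q * ?r] = X [?q] * ?r + ksign (y * z) (X [?r] * ?q) - X [1] * ?q * ?r"
      using GDerD[OF last_GDerD[OF Nil(2), of "[]"] q r] by simp
    have "X [?r] \<in> par (x + z + 1)"
      using Wp_apply[OF X, of "[?r]" "[z + 1]"] Wp_apply_Nil[OF Z] by (simp add: parity_shift_def add_ac)
    then have comm: "X [?r] * ?q = ksign ((x + z + 1) * y) (?q * X [?r])"
      using q by (rule supercomm)
    have YZ: "cp Y Z [?p] = ksign (z * (x + 1)) (Y [?p] * ?r) + ?q * Z [?p]"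
      using fun_cong[OF contract_concat[OF W(2) Z p], of "[]"]
      by (simp add: concat_Nil W W_contract ksign_apply del: contract_apply) (simp add: contract_def)
    have eq1: "WB X (cp Y Z) [] = X [cp Y Z []] - ksign ((x + 1) * (y + z + 1)) (cp Y Z [?p])"
      by (rule bracket_homogeneous_Nil[OF X concat_in_Wp[OF Y Z]])
    show ?case
      unfolding eq1 YZ concat_Nil[OF W(3)] concat_Nil[OF bracket_in_W[OF W(1,3)]] concat_Nil[OF W(2)]
        bracket_homogeneous_Nil[OF X Y] bracket_homogeneous_Nil[OF X Z] bracket_homogeneous_Nil[OF W1_Wp X]
        W_const_apply D comm
      by (cases x; cases y; cases z) (simp_all add: algebra_simps)
  next
    case (Cons a as f ds)
    note a = \<open>a \<in> PA f\<close>
    note X = Cons.prems(1) and L = Cons.prems(2) and Y = Cons.prems(3) and Z = Cons.prems(4)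
    note W = Wp_subset[OF X] Wp_subset[OF Y] Wp_subset[OF Z]
    note C = contract_shifted_parity[OF X a] contract_shifted_parity[OF Y a] contract_shifted_parity[OF Z a]
    note CW = Wp_subset[OF C(1)] Wp_subset[OF C(2)] Wp_subset[OF C(3)]
    note kW = fun_space.subspace_ksign[OF W_subspace]
    note IH = Cons.IH[OF C(1) last_GDer_contract[OF L] Y Z] Cons.IH[OF X L C(2) Z] Cons.IH[OF X L Y C(3)]
    have XY: "WB X Y \<in> WW" and XZ: "WB X Z \<in> WW" and OX: "WB W1 X \<in> WW"
      using W by (simp_all add: bracket_in_W W_const_W)
    have XZp: "WB X Z \<in> Wp (x + z + 1 + 1)"
      using bracket_in_Wp[OF X Z] by (simp add: add_ac)
    have e1: "contract a (WB X (cp Y Z)) =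
        ksign (z * f) (WB X (cp (contract a Y) Z)) + WB X (cp Y (contract a Z))
        + ksign (f * (y + z + 1)) (WB (contract a X) (cp Y Z))"
      unfolding contract_bracket[OF W(1) concat_in_Wp[OF Y Z] a] contract_concat[OF W(2) Z a]
      using W CW by (simp add: bracket_add_right bracket_ksign_right concat_in_W kW
          del: plus_fun_apply contract_apply)
    have e2: "contract a (cp (WB X Y) Z) = ksign (z * f) (cp (WB X (contract a Y)) Z
        + ksign (f * (y + 1)) (cp (WB (contract a X) Y) Z)) + cp (WB X Y) (contract a Z)"
      unfolding contract_concat[OF XY Z a] contract_bracket[OF W(1) Y a] concat_add_left concat_ksign_left ..
    have e3: "contract a (cp Y (WB X Z)) = ksign ((x + z + 1) * f) (cp (contract a Y) (WB X Z))
        + (cp Y (WB X (contract a Z)) + ksign (f * (z + 1)) (cp Y (WB (contract a X) Z)))"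
      unfolding contract_concat[OF W(2) XZp a] contract_bracket[OF W(1) Z a]
      using W CW by (simp add: concat_add_right concat_ksign_right bracket_in_W kW
          del: plus_fun_apply contract_apply)
    have e4: "contract a (cp (cp (WB W1 X) Y) Z) =
        ksign (z * f) (ksign (y * f) (cp (cp (WB W1 (contract a X)) Y) Z)
          + cp (cp (WB W1 X) (contract a Y)) Z) + cp (cp (WB W1 X) Y) (contract a Z)"
      unfolding contract_concat[OF concat_in_W[OF OX W(2)] Z a] contract_concat[OF OX Y a]
        contract_bracket[OF W_const_W X a] contract_W_const bracket_0_left[OF W(1)]
        concat_add_left concat_ksign_left by simp
    have "contract a (WB X (cp Y Z)) as = contract a (cp (WB X Y) Z) as
        + ksign ((x + 1) * y) (contract a (cp Y (WB X Z)) as)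
        + ksign (x + 1) (contract a (cp (cp (WB W1 X) Y) Z) as)"
      unfolding e1 e2 e3 e4 plus_fun_apply ksign_apply IH
      by (cases x; cases y; cases z; cases f) (simp_all add: algebra_simps)
    then show ?case by simp
  qed
  then show "WB X (cp Y Z) as = (cp (WB X Y) Z + ksign ((x + 1) * y) (cp Y (WB X Z))
      + ksign (x + 1) (cp (cp (WB W1 X) Y) Z)) as"
    by (simp add: ksign_apply)
qed


section \<open>The graded odd generalized Poisson superalgebra\<close>

abbreviation "Gq \<equiv> parity_shift Gp"

lemma W1_prolongation: "W1 \<in> prolongation"
proof -
  have "W_const 1 (bs @ [a]) = (0::'a)" for bs a
    by (simp add: W_const_def)
  then show ?thesis by (simp add: prolongation_def W_const_W last_GDer_def GDer_0)
qed

lemma Gq_iff: "X \<in> Gq e \<longleftrightarrow> X \<in> prolongation \<and> X \<in> Wp (e + 1)"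
  by (simp add: parity_shift_def GW_par_eq)

lemma unital_comm_superalgebra_prolongation:
  "unital_comm_superalgebra (fscale scale) prolongation Gq cp W1"
proof -
  interpret Q: superspace "fscale scale" prolongation Gq by (rule GS.superspace_parity_shift)
  show ?thesis
  proof unfold_locales
    show "cp X Y \<in> Gq (d + e)" if "X \<in> Gq d" "Y \<in> Gq e" for X Y d e
      using that concat_in_Wp[of X d Y e] by (simp add: Gq_iff concat_in_prolongation)
    show "cp X Y = ksign (d * e) (cp Y X)" if "X \<in> Gq d" "Y \<in> Gq e" for X Y d e
      using that concat_comm[of X d Y e] by (simp add: Gq_iff)
  qed (simp_all add: prolongation_W concat_in_prolongation concat_add_left concat_add_right
      concat_scale_left concat_scale_right concat_assoc W1_prolongation concat_unit_left
      concat_unit_right del: plus_fun_apply)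
qed

lemma lie_superalgebra_prolongation: "lie_superalgebra (fscale scale) prolongation Gp WB"
proof unfold_locales
  show "WB X Y \<in> Gp (d + e)" if "X \<in> Gp d" "Y \<in> Gp e" for X Y d e
    using that bracket_in_Wp[of X d Y e] by (simp add: GW_par_eq bracket_in_prolongation)
  show "WB X Y = - ksign (d * e) (WB Y X)" if "X \<in> Gp d" "Y \<in> Gp e" for X Y d e
    using that bracket_skew[of X d Y e] by (simp add: GW_par_eq)
  show "WB X (WB Y Z) = WB (WB X Y) Z + ksign (d * e) (WB Y (WB X Z))"
    if "X \<in> Gp d" "Y \<in> Gp e" "Z \<in> prolongation" for X Y Z d e
    using that jacobi[of X d Y e Z] by (simp add: GW_par_eq prolongation_W)
qed (simp_all add: prolongation_W bracket_in_prolongation bracket_add_left bracket_add_right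
      bracket_scale_left bracket_scale_right del: plus_fun_apply)

lemma leibniz_prolongation:
  assumes X: "X \<in> Gq x" and Y: "Y \<in> Gq y" and Z: "Z \<in> prolongation"
  shows "WB X (cp Y Z) = cp (WB X Y) Z + ksign ((x + 1) * y) (cp Y (WB X Z))
    + ksign (x + 1) (cp (cp (WB W1 X) Y) Z)"
  using Z
proof (induction Z rule: GS.homogeneous_induct)
  case (add Z1 Z2)
  have W: "X \<in> WW" "Y \<in> WW" "Z1 \<in> WW" "Z2 \<in> WW"
    using X Y add(1,2) by (simp_all add: Gq_iff prolongation_W)
  show ?case
    unfolding concat_add_right[OF W(3,4)] bracket_add_right[OF W(1) concat_in_W[OF W(2,3)] concat_in_W[OF W(2,4)]]
      bracket_add_right[OF W(1,3,4)] concat_add_right[OF bracket_in_W[OF W(1,3)] bracket_in_W[OF W(1,4)]]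
      ksign_plus add(3,4)
    by (simp add: add_ac del: plus_fun_apply)
next
  case (homogeneous e Z)
  then have "Z \<in> Wp ((e + 1) + 1)" by (simp add: GW_par_eq)
  with X Y show ?case by (intro leibniz_homogeneous[of X x Y y Z "e + 1"]) (simp_all add: Gq_iff prolongation_def)
qed

text \<open>Functions supported on lists of different lengths are linearly independent.\<close>

lemma arity_direct_sum:
  fixes g :: "'i \<Rightarrow> int"
  assumes inj: "inj g" and sub: "\<And>i. fun_space.subspace (U i)"
    and supp: "\<And>i X as. X \<in> U i \<Longrightarrow> int (length as) \<noteq> g i \<Longrightarrow> X as = 0"
    and V: "V = fun_space.span (\<Union>i. U i)"
  shows "fun_space.internal_direct_sum U V"
  unfolding fun_space.internal_direct_sum_def
proof (intro conjI allI impI ballI)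
  fix F f i assume F: "finite F" "\<forall>i\<in>F. f i \<in> U i" "(\<Sum>i\<in>F. f i) = 0" "i \<in> F"
  show "f i = 0"
  proof
    fix as :: "'a list"
    show "f i as = 0 as"
    proof (cases "int (length as) = g i")
      case True
      have "f j as = 0" if "j \<in> F - {i}" for j
      proof (rule supp)
        show "f j \<in> U j" using F(2) that by blast
        show "int (length as) \<noteq> g j" using that True inj_eq[OF inj] by auto
      qed
      then have "(\<Sum>j\<in>F. f j as) = f i as"
        using F(1,4) by (simp add: sum.remove)
      moreover have "(\<Sum>j\<in>F. f j as) = 0" using F(3) by (metis sum_fun_apply zero_fun_apply)
      ultimately show ?thesis by simp
    next
      case False
      have "f i \<in> U i" using F(2,4) by blast
      from supp[OF this False] show ?thesis by simp
    qed
  qed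
qed (use sub V in auto)

lemma GW_hom_subspace: "fun_space.subspace (GH k)"
proof (rule fun_space.subspaceI)
  note sub = prolongation_subspace
  show "0 \<in> GH k" using fun_space.subspace_0[OF sub] by (simp add: GW_hom_eq)
  show "fscale scale c X \<in> GH k" if "X \<in> GH k" for c X
    using that fun_space.subspace_scale[OF sub, of X c] by (simp add: GW_hom_eq) (simp add: fscale_def)
  fix X Y assume "X \<in> GH k" "Y \<in> GH k"
  then have "X + Y \<in> prolongation" "\<forall>as. int (length as) \<noteq> k + 1 \<longrightarrow> (X + Y) as = 0"
    using fun_space.subspace_add[OF sub, of X Y] by (auto simp: GW_hom_eq)
  then show "X + Y \<in> GH k" unfolding GW_hom_eq by blast
qed

lemma GW_hom_Wflip: "X \<in> GH k \<Longrightarrow> Wflip X \<in> GH k"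
  unfolding GW_hom_eq
  by (auto simp: prolongation_flip) (simp add: Wflip_def linmap_eq_0[OF linmap_flip])

lemma GW_hom_eq_0: "X \<in> GH k \<Longrightarrow> int (length as) \<noteq> k + 1 \<Longrightarrow> X as = 0"
  by (simp add: GW_hom_eq)

lemma GW_hom_prolongation: "GH k \<subseteq> prolongation"
  by (auto simp: GW_hom_eq)

lemma GW_hom_parity_sum: "fun_space.internal_direct_sum (\<lambda>e. GH k \<inter> Gp (e + c)) (GH k)"
proof -
  have "GH k \<inter> Gp e = GH k \<inter> Wp e" for e
    using GW_hom_prolongation by (auto simp: GW_par_eq)
  then show ?thesis
    using GW_hom_subspace GW_hom_Wflip GW_hom_prolongation prolongation_W
    by (simp add: parity_direct_sum subset_iff)
qed

lemma GW_hom_bracket: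
  assumes X: "X \<in> GH i" and Y: "Y \<in> GH j" shows "WB X Y \<in> GH (i + j)"
proof -
  have P: "X \<in> prolongation" "Y \<in> prolongation" using X Y GW_hom_prolongation by blast+
  note W = prolongation_W[OF P(1)] prolongation_W[OF P(2)]
  have box0: "bx (hcomp Wp d X) (hcomp Wp e Y) as = 0 \<and> bx (hcomp Wp e Y) (hcomp Wp d X) as = 0"
    if len: "int (length as) \<noteq> i + j + 1" for d e as
  proof -
    \<comment> \<open>The parity components of a function of degree \<open>k\<close> have degree \<open>k\<close>.\<close>
    have zero: "hcomp Wp d V bs = 0" if V: "V \<in> GH k" and bs: "int (length bs) \<noteq> k + 1" for V k d bs
    proof -
      interpret K: superspace "fscale scale" "GH k" "\<lambda>e. GH k \<inter> Gp (e + 0)"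
        by unfold_locales (rule GW_hom_parity_sum)
      obtain y z where yz: "y \<in> GH k \<inter> Gp (d + 0)" "z \<in> GH k \<inter> Gp (d + 1 + 0)" "V = y + z"
        using K.V_decomp[OF V] by blast
      then have "hcomp Wp d V = y" using WS.hcomp_eq[of y d z] by (simp add: GW_par_eq)
      with yz bs show ?thesis by (simp add: GW_hom_eq)
    qed
    have len': "int m \<noteq> i + 1 \<or> int n \<noteq> j + 1" if "m + n = Suc (length as)" for m n
      using len that by linarith
    have "(\<forall>bs. length bs = m \<longrightarrow> hcomp Wp e Y bs = 0) \<or> (\<forall>bs. length bs = Suc n \<longrightarrow> hcomp Wp d X bs = 0)"
      "(\<forall>bs. length bs = m \<longrightarrow> hcomp Wp d X bs = 0) \<or> (\<forall>bs. length bs = Suc n \<longrightarrow> hcomp Wp e Y bs = 0)"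
      if "m + n = length as" for m n
      using len'[of "Suc n" m] len'[of m "Suc n"] that zero[OF X] zero[OF Y] by auto
    then show ?thesis by (intro conjI box_eq_0 hcomp_W_multilinear W)
  qed
  have "WB X Y as = 0" if "int (length as) \<noteq> i + j + 1" for as
    unfolding W_bracket_def Let_def
    by (simp add: sum_UNIV_bit ksign_apply box0[OF that])
  then show ?thesis using bracket_in_prolongation[OF P] by (simp add: GW_hom_eq)
qed

lemma GW_hom_concat:
  assumes X: "X \<in> GH (int h - 1)" and Y: "Y \<in> GH (int k - 1)"
  shows "cp X Y \<in> GH (int (h + k) - 1)"
proof -
  interpret K: superspace "fscale scale" "GH (int k - 1)" "\<lambda>e. GH (int k - 1) \<inter> Gp (e + 0)"
    by unfold_locales (rule GW_hom_parity_sum)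
  have P: "X \<in> prolongation" "Y \<in> prolongation" using X Y GW_hom_prolongation by blast+
  have "\<forall>as. length as \<noteq> h + k \<longrightarrow> cp X Y as = 0"
    using Y
  proof (induction Y rule: K.homogeneous_induct)
    case (add Y1 Y2)
    then have "Y1 \<in> WW" "Y2 \<in> WW" using GW_hom_prolongation prolongation_W by blast+
    then have eq: "cp X (Y1 + Y2) = cp X Y1 + cp X Y2" by (rule concat_add_right)
    show ?case unfolding eq using add(3,4) by simp
  next
    case (homogeneous e Y)
    then have "Y \<in> Wp e" by (simp add: GW_par_eq)
    show ?case
    proof (intro allI impI concat_eq_0[OF \<open>Y \<in> Wp e\<close>])
      fix as :: "'a list" and i j assume "length as \<noteq> h + k" "i + j = length as"
      then have "i \<noteq> h \<or> j \<noteq> k" by auto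
      then show "(\<forall>bs. length bs = i \<longrightarrow> X bs = 0) \<or> (\<forall>bs. length bs = j \<longrightarrow> Y bs = 0)"
        using X homogeneous by (auto simp: GW_hom_eq)
    qed
  qed
  then show ?thesis using concat_in_prolongation[OF P] by (simp add: GW_hom_eq)
qed

lemma Zplus_graded_prolongation:
  "Zplus_graded_odd_generalized_poisson_superalgebra (fscale scale)
     prolongation Gq WB cp W1 GH (\<lambda>k. GH (int k - 1))"
proof -
  interpret U: unital_comm_superalgebra "fscale scale" prolongation Gq cp W1
    by (rule unital_comm_superalgebra_prolongation)
  interpret L: lie_superalgebra "fscale scale" prolongation "parity_shift Gq" WB
    using lie_superalgebra_prolongation by simp
  have span: "prolongation = fun_space.span (\<Union>k. GH k)"
    using GW_eq by (simp add: GW_def)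
  show ?thesis
  proof unfold_locales
    show "WB X (cp Y Z) = cp (WB X Y) Z + ksign ((x + 1) * y) (cp Y (WB X Z))
        + ksign (x + 1) (cp (cp (WB W1 X) Y) Z)"
      if "X \<in> Gq x" "Y \<in> Gq y" "Z \<in> prolongation" for X Y Z x y
      using that by (rule leibniz_prolongation)
    show "fun_space.internal_direct_sum GH prolongation"
    proof (rule arity_direct_sum[of "\<lambda>k. k + 1"])
      show "inj (\<lambda>k :: int. k + 1)" by (simp add: inj_def)
    qed (fact GW_hom_subspace GW_hom_eq_0 span)+
    show "fun_space.internal_direct_sum (\<lambda>e. GH j \<inter> parity_shift Gq e) (GH j)" for j
      using GW_hom_parity_sum[of j 0] by simp
    show "GH j = {0}" if "j < -1" for j
      using that by (simp add: GW_hom_def)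
    show "WB X Y \<in> GH (i + j)" if "X \<in> GH i" "Y \<in> GH j" for X Y i j
      using that by (rule GW_hom_bracket)
    show "fun_space.internal_direct_sum (\<lambda>k. GH (int k - 1)) prolongation"
    proof (rule arity_direct_sum[of int])
      have "(\<Union>k. GH k) \<subseteq> fun_space.span (\<Union>k. GH (int k - 1))"
      proof clarify
        fix X k assume X: "X \<in> GH k"
        show "X \<in> fun_space.span (\<Union>k. GH (int k - 1))"
        proof (cases "k < -1")
          case True
          with X show ?thesis by (simp add: GW_hom_def fun_space.span_zero)
        next
          case False
          then have "int (nat (k + 1)) - 1 = k" by simp
          with X show ?thesis by (intro fun_space.span_base) (metis UN_I UNIV_I)
        qed
      qed
      then have "fun_space.span (\<Union>k. GH k) \<subseteq> fun_space.span (\<Union>k. GH (int k - 1))"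
        by (intro fun_space.span_minimal) simp_all
      moreover have "fun_space.span (\<Union>k. GH (int k - 1)) \<subseteq> fun_space.span (\<Union>k. GH k)"
        by (intro fun_space.span_mono) auto
      ultimately show "prolongation = fun_space.span (\<Union>k. GH (int k - 1))" using span by simp
    qed (auto simp: inj_def GW_hom_subspace intro: GW_hom_eq_0)
    show "fun_space.internal_direct_sum (\<lambda>e. GH (int k - 1) \<inter> Gq e) (GH (int k - 1))" for k
      using GW_hom_parity_sum[of "int k - 1" 1] by (simp add: parity_shift_def)
    show "cp X Y \<in> GH (int (h + k) - 1)" if "X \<in> GH (int h - 1)" "Y \<in> GH (int k - 1)" for X Y h k
      using that by (rule GW_hom_concat)
    show "GH j = GH (int (nat (j + 1)) - 1)" if "- 1 \<le> j" for j
      using that by simp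
  qed
qed

end

theorem proposition3p4:
  fixes scale :: "'f::{alg_closed_field,field_char_0} \<Rightarrow> 'a::{ring,monoid_mult} \<Rightarrow> 'a"
    and par :: "bit \<Rightarrow> 'a set"
  assumes "unital_comm_superalgebra scale UNIV par (*) 1"
  shows "Zplus_graded_odd_generalized_poisson_superalgebra (fscale scale)
           (GW scale par) (parity_shift (GW_par scale par))
           (W_bracket scale par) (concat_prod scale par) (W_const 1)
           (GW_hom scale par) (\<lambda>k. GW_hom scale par (int k - 1))"
proof -
  interpret comm_superalgebra_char_0 scale par
    using assms by (rule comm_superalgebra_char_0.intro)
  show ?thesis unfolding GW_eq by (rule Zplus_graded_prolongation)
qed

end
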